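(* Let $R=K[x,y,z,u]$ be the polynomial ring over a field $K$. For every non-negative integer $c$ there exist (monomial) ideals $I$ and $J$ of $R$ such that $\operatorname{astab}(I)-\operatorname{dstab}(I)\geq c$ and $\operatorname{dstab}(J)-\operatorname{astab}(J)\geq c$.
   Context: For an ideal $I$: $\operatorname{astab}(I)$ is the smallest positive integer $k_0$ with $\operatorname{Ass}(R/I^k)=\operatorname{Ass}(R/I^{k_0})$ for all $k\geq k_0$; $\operatorname{dstab}(I)$ is the smallest positive integer $k_0$ with $\operatorname{depth} R/I^k=\operatorname{depth} R/I^{k_0}$ for all $k\geq k_0$. Depth is with respect to the graded maximal ideal. *)

theory Defs
  imports "HOL-Library.Poly_Mapping"
begin

datatype var = Vx | Vy | Vz | Vu

text \<open>R = K[x,y,z,u]: finitely supported maps from monomials (exponent vectors) to K.\<close>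
type_synonym 'k poly4 = "(var \<Rightarrow>\<^sub>0 nat) \<Rightarrow>\<^sub>0 'k"

definition is_ideal :: "'a::comm_ring_1 set \<Rightarrow> bool" where
  "is_ideal I \<longleftrightarrow> 0 \<in> I \<and> (\<forall>a\<in>I. \<forall>b\<in>I. a + b \<in> I) \<and> (\<forall>r. \<forall>a\<in>I. r * a \<in> I)"

definition ideal_gen :: "'a::comm_ring_1 set \<Rightarrow> 'a set" where
  "ideal_gen S = \<Inter> {J. is_ideal J \<and> S \<subseteq> J}"

definition ideal_sum :: "'a::comm_ring_1 set \<Rightarrow> 'a set \<Rightarrow> 'a set" where
  "ideal_sum I J = ideal_gen (I \<union> J)"

definition ideal_prod :: "'a::comm_ring_1 set \<Rightarrow> 'a set \<Rightarrow> 'a set" where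
  "ideal_prod I J = ideal_gen {a * b | a b. a \<in> I \<and> b \<in> J}"

primrec ideal_pow :: "'a::comm_ring_1 set \<Rightarrow> nat \<Rightarrow> 'a set" where
  "ideal_pow I 0 = UNIV"
| "ideal_pow I (Suc k) = ideal_prod I (ideal_pow I k)"

definition is_prime_ideal :: "'a::comm_ring_1 set \<Rightarrow> bool" where
  "is_prime_ideal P \<longleftrightarrow> is_ideal P \<and> P \<noteq> UNIV \<and> (\<forall>a b. a * b \<in> P \<longrightarrow> a \<in> P \<or> b \<in> P)"

text \<open>Ass(R/I): prime ideals of the form (I : f) = Ann_R(f + I).\<close>
definition Ass :: "'a::comm_ring_1 set \<Rightarrow> 'a set set" where
  "Ass I = {P. is_prime_ideal P \<and> (\<exists>f. P = {g. g * f \<in> I})}"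

definition monomial_ideal :: "'k::field poly4 set \<Rightarrow> bool" where
  "monomial_ideal I \<longleftrightarrow> is_ideal I \<and>
     (\<forall>f\<in>I. \<forall>m\<in>Poly_Mapping.keys f. Poly_Mapping.single m (1::'k) \<in> I)"

definition graded_max :: "'k::field poly4 set" where
  "graded_max = {f. Poly_Mapping.lookup f 0 = 0}"

definition regular_seq :: "'k::field poly4 set \<Rightarrow> 'k poly4 list \<Rightarrow> bool" where
  "regular_seq J fs \<longleftrightarrow> set fs \<subseteq> graded_max \<and>
     (\<forall>i<length fs. \<forall>g. g * fs ! i \<in> ideal_sum J (ideal_gen (set (take i fs)))
                         \<longrightarrow> g \<in> ideal_sum J (ideal_gen (set (take i fs)))) \<and>
     ideal_sum J (ideal_gen (set fs)) \<noteq> UNIV"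

definition depth_quot :: "'k::field poly4 set \<Rightarrow> nat" where
  "depth_quot J = Sup {length fs | fs. regular_seq J fs}"

definition astab :: "'k::field poly4 set \<Rightarrow> nat" where
  "astab I = (LEAST k0. 0 < k0 \<and> (\<forall>k\<ge>k0. Ass (ideal_pow I k) = Ass (ideal_pow I k0)))"

definition dstab :: "'k::field poly4 set \<Rightarrow> nat" where
  "dstab I = (LEAST k0. 0 < k0 \<and> (\<forall>k\<ge>k0. depth_quot (ideal_pow I k) = depth_quot (ideal_pow I k0)))"

end

theory Submission
  imports Defs "HOL-Library.Product_Lexorder"
begin

text \<open>Put \<open>D = e + 1\<close> and \<open>Q = (x\<^sup>D, x\<^sup>e y, x y\<^sup>e, y\<^sup>D)\<close>. The powers \<open>Q\<^sup>k\<close> have gaps, and they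
  agree with \<open>(x, y)\<^bsup>Dk\<^esup>\<close> only from \<open>k = e - 1\<close> on. With \<open>m\<close> the graded maximal ideal, the powers of
  \<open>I = Q m + z (x, y)\<^sup>D\<close> always have depth 0, while \<open>(x, y, z)\<close> is associated to \<open>I\<^sup>k\<close> until the gaps of
  \<open>Q\<^sup>k\<close> close. For \<open>J = Q \<inter> (z, u)\<^sup>D \<inter> (x, u)\<^sup>D \<inter> (y, z)\<^sup>D\<close> the powers of \<open>J\<close> are the
  intersections of the powers of the four components, hence have constant associated primes. For large \<open>k\<close> one gets
  \<open>J\<^sup>k = (xz, yu)\<^bsup>Dk\<^esup>\<close>, of depth 2; for smaller \<open>k\<close> a monomial in a gap of \<open>Q\<^sup>k\<close> at which the degree
  complex is disconnected forces depth at most 1. Depths are bounded from above by nonzero Koszul cohomology: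
  if \<open>f = \<Sum> g\<^sub>l x\<^sub>l\<close> is a nonzerodivisor on \<open>R/N\<close>, contraction with \<open>g\<close> maps nonzero classes of degree
  \<open>d\<close> over \<open>R/N\<close> to nonzero classes of degree \<open>d - 1\<close> over \<open>R/(N + f)\<close>.\<close>

abbreviation "monom m \<equiv> Poly_Mapping.single m (1::'k::field)"
abbreviation ex :: "(var \<Rightarrow>\<^sub>0 nat) \<Rightarrow> var \<Rightarrow> nat" where "ex \<equiv> Poly_Mapping.lookup"

section \<open>Spans of monomials\<close>

text \<open>Every monomial ideal is \<open>mspan U\<close> for an up-closed \<open>U\<close>.
  Intersections of ideals become intersections of exponent sets, products become sumsets.\<close>

definition mspan :: "(var \<Rightarrow>\<^sub>0 nat) set \<Rightarrow> 'k::field poly4 set" where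
  "mspan U = {f. Poly_Mapping.keys f \<subseteq> U}"

definition upset :: "'a::plus set \<Rightarrow> bool" where
  "upset U \<longleftrightarrow> (\<forall>m\<in>U. \<forall>n. m + n \<in> U)"

lemma poly_mapping_sum_single:
  fixes f :: "'a \<Rightarrow>\<^sub>0 'b::comm_monoid_add"
  shows "f = (\<Sum>a\<in>Poly_Mapping.keys f. Poly_Mapping.single a (Poly_Mapping.lookup f a))"
proof (rule poly_mapping_eqI)
  fix k
  have "(\<Sum>a\<in>Poly_Mapping.keys f. Poly_Mapping.lookup (Poly_Mapping.single a (Poly_Mapping.lookup f a)) k)
      = (\<Sum>a\<in>Poly_Mapping.keys f. if a = k then Poly_Mapping.lookup f k else 0)"
    by (rule sum.cong) (auto simp: lookup_single when_def)
  then show "Poly_Mapping.lookup f k =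
      Poly_Mapping.lookup (\<Sum>a\<in>Poly_Mapping.keys f. Poly_Mapping.single a (Poly_Mapping.lookup f a)) k"
    by (simp add: lookup_sum in_keys_iff)
qed

text \<open>With no second pair of support points summing to \<open>p + q\<close> nothing can
  cancel. Applied to least terms and to multiplication by a single term.\<close>

lemma lookup_mult_unique:
  fixes f g :: "'a::comm_monoid_add \<Rightarrow>\<^sub>0 'b::comm_ring_1"
  assumes "\<And>a b. a \<in> Poly_Mapping.keys f \<Longrightarrow> b \<in> Poly_Mapping.keys g \<Longrightarrow> a + b = p + q \<Longrightarrow> a = p \<and> b = q"
  shows "Poly_Mapping.lookup (f * g) (p + q) = Poly_Mapping.lookup f p * Poly_Mapping.lookup g q"
proof -
  let ?K = "Poly_Mapping.keys f \<times> Poly_Mapping.keys g"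
  let ?c = "\<lambda>(a, b). Poly_Mapping.lookup f a * Poly_Mapping.lookup g b"
  have "f * g = (\<Sum>ab\<in>?K. Poly_Mapping.single (fst ab + snd ab) (?c ab))"
    using arg_cong2[of _ _ _ _ "(*)", OF poly_mapping_sum_single[of f] poly_mapping_sum_single[of g]]
    by (simp add: sum_product sum.cartesian_product mult_single case_prod_beta)
  then have "Poly_Mapping.lookup (f * g) (p + q)
      = (\<Sum>ab\<in>?K. Poly_Mapping.lookup (Poly_Mapping.single (fst ab + snd ab) (?c ab)) (p + q))"
    by (simp only: lookup_sum)
  also have "\<dots> = (\<Sum>ab\<in>?K. if ab = (p, q) then ?c (p, q) else 0)"
    by (rule sum.cong) (use assms in \<open>auto simp: lookup_single when_def\<close>)
  also have "\<dots> = ?c (p, q)"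
    by (auto simp: in_keys_iff)
  finally show ?thesis by simp
qed

lemma lookup_single_mult:
  fixes f :: "'k::field poly4"
  shows "Poly_Mapping.lookup (Poly_Mapping.single t c * f) (t + m) = c * Poly_Mapping.lookup f m"
  by (subst lookup_mult_unique) (auto split: if_splits)

lemma keys_monom_mult:
  fixes f :: "'k::field poly4"
  shows "Poly_Mapping.keys (monom t * f) = (+) t ` Poly_Mapping.keys f"
proof
  show "Poly_Mapping.keys (monom t * f) \<subseteq> (+) t ` Poly_Mapping.keys f"
    using keys_mult[of "monom t" f] by auto
  show "(+) t ` Poly_Mapping.keys f \<subseteq> Poly_Mapping.keys (monom t * f)"
    by (auto simp: in_keys_iff lookup_single_mult)
qed

lemma mspan_single [simp]: "Poly_Mapping.single m c \<in> mspan U \<longleftrightarrow> m \<in> U \<or> c = 0"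
  by (auto simp: mspan_def)

lemma mspan_lookup: "f \<in> mspan U \<Longrightarrow> m \<notin> U \<Longrightarrow> Poly_Mapping.lookup f m = 0"
  by (auto simp: mspan_def in_keys_iff)

lemma is_ideal_mspan:
  assumes "upset U" shows "is_ideal (mspan U :: 'k::field poly4 set)"
  unfolding is_ideal_def
proof (intro conjI ballI allI)
  show "(0::'k poly4) \<in> mspan U" by (simp add: mspan_def)
next
  fix f g :: "'k poly4" assume "f \<in> mspan U" "g \<in> mspan U"
  then show "f + g \<in> mspan U" using keys_add[of f g] by (auto simp: mspan_def)
next
  fix r f :: "'k poly4" assume "f \<in> mspan U"
  then show "r * f \<in> mspan U"
    using keys_mult[of r f] assms by (fastforce simp: mspan_def upset_def add.commute)
qed

lemma monomial_ideal_mspan: "upset U \<Longrightarrow> monomial_ideal (mspan U)"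
  by (auto simp: monomial_ideal_def is_ideal_mspan) (auto simp: mspan_def)

section \<open>Ideal arithmetic\<close>

lemma is_idealD:
  assumes "is_ideal I"
  shows "0 \<in> I" "a \<in> I \<Longrightarrow> b \<in> I \<Longrightarrow> a + b \<in> I" "a \<in> I \<Longrightarrow> r * a \<in> I" "a \<in> I \<Longrightarrow> a * r \<in> I"
    "a \<in> I \<Longrightarrow> - a \<in> I" "a \<in> I \<Longrightarrow> b \<in> I \<Longrightarrow> a - b \<in> I"
proof -
  show 1: "0 \<in> I" "a \<in> I \<Longrightarrow> b \<in> I \<Longrightarrow> a + b \<in> I" "\<And>a r. a \<in> I \<Longrightarrow> r * a \<in> I" for a b
    using assms by (auto simp: is_ideal_def)
  show "a \<in> I \<Longrightarrow> a * r \<in> I" using 1(3)[of a r] by (simp add: mult.commute)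
  show 2: "a \<in> I \<Longrightarrow> - a \<in> I" for a using 1(3)[of a "-1"] by simp
  show "a \<in> I \<Longrightarrow> b \<in> I \<Longrightarrow> a - b \<in> I" using 1(2)[of a "- b"] 2 by simp
qed

lemma ideal_sum_mem:
  assumes "is_ideal I" "\<And>x. x \<in> A \<Longrightarrow> f x \<in> I" shows "sum f A \<in> I"
  using assms by (induction A rule: infinite_finite_induct) (auto intro: is_idealD)

lemma is_ideal_gen: "is_ideal (ideal_gen S)"
  by (auto simp: ideal_gen_def is_ideal_def)

lemma ideal_gen_superset: "S \<subseteq> ideal_gen S"
  by (auto simp: ideal_gen_def)

lemma ideal_gen_least: "is_ideal I \<Longrightarrow> S \<subseteq> I \<Longrightarrow> ideal_gen S \<subseteq> I"
  by (auto simp: ideal_gen_def)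

lemma ideal_gen_eqI: "is_ideal I \<Longrightarrow> S \<subseteq> I \<Longrightarrow> (\<And>J. is_ideal J \<Longrightarrow> S \<subseteq> J \<Longrightarrow> I \<subseteq> J) \<Longrightarrow> ideal_gen S = I"
  unfolding ideal_gen_def by blast

lemma ideal_prod_mspan:
  assumes "upset A" "upset B" "C = {a + b | a b. a \<in> A \<and> b \<in> B}"
  shows "ideal_prod (mspan A) (mspan B) = (mspan C :: 'k::field poly4 set)"
  unfolding ideal_prod_def
proof (rule ideal_gen_eqI)
  have "upset C"
    using assms unfolding upset_def by (auto simp: add.assoc) blast
  then show "is_ideal (mspan C :: 'k poly4 set)" by (rule is_ideal_mspan)
  show "{a * b |a b. a \<in> mspan A \<and> b \<in> mspan B} \<subseteq> (mspan C :: 'k poly4 set)"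
  proof clarify
    fix f g :: "'k poly4" assume "f \<in> mspan A" "g \<in> mspan B"
    then show "f * g \<in> mspan C" using keys_mult[of f g] assms(3) by (fastforce simp: mspan_def)
  qed
next
  fix J :: "'k poly4 set"
  assume J: "is_ideal J" "{a * b |a b. a \<in> mspan A \<and> b \<in> mspan B} \<subseteq> J"
  show "mspan C \<subseteq> J"
  proof
    fix f :: "'k poly4" assume f: "f \<in> mspan C"
    have "(\<Sum>m\<in>Poly_Mapping.keys f. Poly_Mapping.single m (Poly_Mapping.lookup f m)) \<in> J"
    proof (rule ideal_sum_mem[OF J(1)])
      fix m assume "m \<in> Poly_Mapping.keys f"
      then obtain a b where ab: "a \<in> A" "b \<in> B" "m = a + b" using f assms(3) by (auto simp: mspan_def)
      have "monom a * Poly_Mapping.single b (Poly_Mapping.lookup f m) \<in> J"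
        using J(2) ab by (auto intro!: subsetD[OF J(2)] exI)
      then show "Poly_Mapping.single m (Poly_Mapping.lookup f m) \<in> J"
        using ab by (simp add: mult_single)
    qed
    then show "f \<in> J" using poly_mapping_sum_single[of f] by simp
  qed
qed

text \<open>Reduces powers to combinatorics: a guessed family \<open>S\<close> of exponent sets is
  confirmed by its sumset recursion alone.\<close>

lemma ideal_pow_mspan:
  assumes "\<And>k. upset (S k)" "S 0 = UNIV" "\<And>k. S (Suc k) = {a + b | a b. a \<in> S 1 \<and> b \<in> S k}"
  shows "ideal_pow (mspan (S 1)) k = (mspan (S k) :: 'k::field poly4 set)"
proof (induction k)
  case 0 then show ?case by (simp add: assms(2) mspan_def)
next
  case (Suc k)
  then show ?case
    by (simp only: ideal_pow.simps) (rule ideal_prod_mspan[OF assms(1) assms(1) assms(3)])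
qed

section \<open>Associated primes of monomial ideals\<close>

definition vprime :: "var set \<Rightarrow> 'k::field poly4 set" where
  "vprime V = mspan {m. \<exists>v\<in>V. ex m v \<noteq> 0}"

lemma UNIV_var: "(UNIV :: var set) = {Vx, Vy, Vz, Vu}"
  by (auto intro: var.exhaust)

lemma finite_var [simp]: "finite (V :: var set)"
  by (rule finite_subset[OF subset_UNIV]) (simp add: UNIV_var)

lemma monom_eqI:
  assumes "ex a Vx = ex b Vx" "ex a Vy = ex b Vy" "ex a Vz = ex b Vz" "ex a Vu = ex b Vu"
  shows "a = b"
proof (rule poly_mapping_eqI)
  fix v show "ex a v = ex b v" using assms by (cases v) auto
qed

text \<open>The \<open>V\<close>-degree comes first, so that the least monomial of a polynomial outside \<open>vprime V\<close>
  is free of the variables in \<open>V\<close>.\<close>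

definition lex_key :: "var set \<Rightarrow> (var \<Rightarrow>\<^sub>0 nat) \<Rightarrow> nat \<times> nat \<times> nat \<times> nat \<times> nat" where
  "lex_key V m = (\<Sum>v\<in>V. ex m v, ex m Vx, ex m Vy, ex m Vz, ex m Vu)"

text \<open>Keys are additive and the lexicographic order is strictly compatible with addition, so a
  strict inequality in either summand would make the key of \<open>a + b\<close> exceed that of
  \<open>p + q\<close>.\<close>

lemma lex_key_add_unique:
  assumes "lex_key V p \<le> lex_key V a" "lex_key V q \<le> lex_key V b" "a + b = p + q"
  shows "a = p \<and> b = q"
proof -
  have s: "(\<Sum>v\<in>V. ex a v) + (\<Sum>v\<in>V. ex b v) = (\<Sum>v\<in>V. ex p v) + (\<Sum>v\<in>V. ex q v)"
    using arg_cong[OF assms(3), of "\<lambda>m. \<Sum>v\<in>V. ex m v"] by (simp add: lookup_add sum.distrib)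
  have e: "ex a v + ex b v = ex p v + ex q v" for v
    using arg_cong[OF assms(3), of "\<lambda>m. ex m v"] by (simp add: lookup_add)
  have "ex a Vx = ex p Vx \<and> ex a Vy = ex p Vy \<and> ex a Vz = ex p Vz \<and> ex a Vu = ex p Vu"
    using assms(1,2) s e[of Vx] e[of Vy] e[of Vz] e[of Vu]
    by (auto simp: lex_key_def)
  then have "a = p" by (intro monom_eqI) simp_all
  then show ?thesis using assms(3) by simp
qed

lemma lex_key_min_exists:
  assumes "f \<noteq> 0"
  obtains p where "p \<in> Poly_Mapping.keys f" "\<And>a. a \<in> Poly_Mapping.keys f \<Longrightarrow> lex_key V p \<le> lex_key V a"
proof -
  have "finite (Poly_Mapping.keys f)" "Poly_Mapping.keys f \<noteq> {}" using assms by auto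
  then have "Min (lex_key V ` Poly_Mapping.keys f) \<in> lex_key V ` Poly_Mapping.keys f"
    by (intro Min_in) auto
  then obtain p where "p \<in> Poly_Mapping.keys f" "lex_key V p = Min (lex_key V ` Poly_Mapping.keys f)"
    by auto
  then show ?thesis by (intro that[of p]) auto
qed

text \<open>Says that the span of \<open>U\<close> is extended from the polynomial ring in the
  variables of \<open>V\<close>. If it is proper and contains a power of each of these, it is
  primary to \<open>vprime V\<close>.\<close>

definition depends_on :: "var set \<Rightarrow> (var \<Rightarrow>\<^sub>0 nat) set \<Rightarrow> bool" where
  "depends_on V U \<longleftrightarrow> (\<forall>m n. (\<forall>v\<in>V. ex m v = ex n v) \<longrightarrow> m \<in> U \<longrightarrow> n \<in> U)"

text \<open>The least term of \<open>g\<close> is free of the variables in \<open>V\<close>. Its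
  product with the least term of \<open>f\<close> outside \<open>U\<close> survives in the product,
  and membership in \<open>U\<close> does not see the factor coming from \<open>g\<close>.\<close>

lemma mspan_primary:
  fixes f g :: "'k::field poly4"
  assumes U: "upset U" "depends_on V U" and g: "g \<notin> vprime V" and fg: "g * f \<in> mspan U"
  shows "f \<in> mspan U"
proof (rule ccontr)
  assume nf: "f \<notin> mspan U"
  define f0 where "f0 = (\<Sum>a\<in>Poly_Mapping.keys f \<inter> U. Poly_Mapping.single a (Poly_Mapping.lookup f a))"
  have f0: "f0 \<in> mspan U" unfolding f0_def by (rule ideal_sum_mem[OF is_ideal_mspan[OF U(1)]]) simp
  define f1 where "f1 = f - f0"
  have l: "Poly_Mapping.lookup f0 a = (if a \<in> U then Poly_Mapping.lookup f a else 0)" for a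
  proof -
    have "Poly_Mapping.lookup f0 a = (\<Sum>b\<in>Poly_Mapping.keys f \<inter> U. if b = a then Poly_Mapping.lookup f a else 0)"
      unfolding f0_def lookup_sum by (rule sum.cong) (auto simp: lookup_single when_def)
    then show ?thesis by (simp add: in_keys_iff)
  qed
  have f1: "a \<notin> U" if "a \<in> Poly_Mapping.keys f1" for a
    using that by (auto simp: in_keys_iff f1_def lookup_minus l split: if_splits)
  have "f1 \<noteq> 0" using nf f0 by (auto simp: f1_def)
  then obtain q where q: "q \<in> Poly_Mapping.keys f1"
    "\<And>a. a \<in> Poly_Mapping.keys f1 \<Longrightarrow> lex_key V q \<le> lex_key V a"
    by (rule lex_key_min_exists[where V = V]) blast
  obtain p0 where p0: "p0 \<in> Poly_Mapping.keys g" "\<forall>v\<in>V. \<not> ex p0 v \<noteq> 0"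
    using g unfolding vprime_def mspan_def by blast
  then have "g \<noteq> 0" by auto
  then obtain p where p: "p \<in> Poly_Mapping.keys g"
    "\<And>a. a \<in> Poly_Mapping.keys g \<Longrightarrow> lex_key V p \<le> lex_key V a"
    by (rule lex_key_min_exists[where V = V]) blast
  have "(\<Sum>v\<in>V. ex p v) \<le> (\<Sum>v\<in>V. ex p0 v)"
    using p(2)[OF p0(1)] by (auto simp: lex_key_def less_eq_prod_def)
  then have pV: "\<forall>v\<in>V. ex p v = 0" using p0(2) by simp
  have "Poly_Mapping.lookup (g * f1) (p + q) = Poly_Mapping.lookup g p * Poly_Mapping.lookup f1 q"
    by (rule lookup_mult_unique) (use lex_key_add_unique p(2) q(2) in blast)
  also have "\<dots> \<noteq> 0" using p(1) q(1) by (simp add: in_keys_iff)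
  finally have "p + q \<in> Poly_Mapping.keys (g * f1)" by (simp add: in_keys_iff)
  moreover have "g * f1 \<in> mspan U"
    unfolding f1_def right_diff_distrib
    using is_idealD(6)[OF is_ideal_mspan[OF U(1)] fg is_idealD(3)[OF is_ideal_mspan[OF U(1)] f0]] .
  ultimately have "p + q \<in> U" by (auto simp: mspan_def)
  moreover have "\<forall>v\<in>V. ex (p + q) v = ex q v" using pV by (simp add: lookup_add)
  ultimately have "q \<in> U" using U(2) unfolding depends_on_def by blast
  with f1[OF q(1)] show False by simp
qed

lemma upset_vprime: "upset {m. \<exists>v\<in>V. ex m v \<noteq> 0}"
  by (auto simp: upset_def lookup_add)

lemma is_prime_vprime: "is_prime_ideal (vprime V)"
  unfolding is_prime_ideal_def
proof (intro conjI allI impI)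
  show "is_ideal (vprime V)" unfolding vprime_def by (rule is_ideal_mspan[OF upset_vprime])
  have "1 \<notin> vprime V" by (auto simp: vprime_def mspan_def)
  then show "vprime V \<noteq> UNIV" by blast
  fix a b :: "'a poly4" assume ab: "a * b \<in> vprime V"
  show "a \<in> vprime V \<or> b \<in> vprime V"
    using mspan_primary[OF upset_vprime _ _ ab[unfolded vprime_def], of V, folded vprime_def]
    by (auto simp: depends_on_def)
qed

lemma inj_vprime: "inj (vprime :: var set \<Rightarrow> 'k::field poly4 set)"
proof (rule injI)
  have *: "v \<in> V \<longleftrightarrow> monom (Poly_Mapping.single v 1) \<in> (vprime V :: 'k poly4 set)" for v V
    by (auto simp: vprime_def lookup_single when_def)
  fix V W assume "vprime V = (vprime W :: 'k poly4 set)"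
  then show "V = W" using *[of _ V] *[of _ W] by auto
qed

text \<open>The monomial with exponent \<open>p\<close> serves as \<open>f\<close>: its colon ideal
  is read off monomial by monomial.\<close>

lemma vprime_in_Ass:
  assumes "\<And>m. m + p \<in> U \<longleftrightarrow> (\<exists>v\<in>V. ex m v \<noteq> 0)"
  shows "vprime V \<in> Ass (mspan U :: 'k::field poly4 set)"
proof -
  have "g * monom p \<in> mspan U \<longleftrightarrow> g \<in> vprime V" for g :: "'k poly4"
    using assms by (subst mult.commute) (auto simp: mspan_def vprime_def keys_monom_mult add.commute)
  then show ?thesis by (auto simp: Ass_def is_prime_vprime)
qed

text \<open>The sets \<open>U V\<close> give a primary decomposition, and \<open>N\<close> is a
  uniform exponent for which powers of the variables lie in the components. A prime colon ideal
  equals the colon ideal of one component, and primarity pins that down to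
  \<open>vprime V\<close>.\<close>

lemma Ass_mspan_subset:
  fixes F :: "var set set"
  assumes fin: "finite F" and S: "S = (\<Inter>V\<in>F. U V)"
    and U: "\<And>V. V \<in> F \<Longrightarrow> upset (U V)" "\<And>V. V \<in> F \<Longrightarrow> depends_on V (U V)"
    and N: "\<And>V v m. V \<in> F \<Longrightarrow> v \<in> V \<Longrightarrow> N \<le> ex m v \<Longrightarrow> m \<in> U V"
  shows "Ass (mspan S :: 'k::field poly4 set) \<subseteq> vprime ` F"
proof
  fix P :: "'k poly4 set" assume "P \<in> Ass (mspan S)"
  then obtain f where P: "is_prime_ideal P" "P = {g. g * f \<in> mspan S}" by (auto simp: Ass_def)
  have eq: "P = (\<Inter>V\<in>F. {g. g * f \<in> mspan (U V)})" unfolding P(2) S by (auto simp: mspan_def)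
  have I: "is_ideal P" using P(1) by (simp add: is_prime_ideal_def)
  have nP1: "1 \<notin> P"
  proof
    assume "1 \<in> P"
    then have "r * 1 \<in> P" for r by (rule is_idealD(3)[OF I])
    then show False using P(1) by (auto simp: is_prime_ideal_def)
  qed
  have pp: "\<exists>x\<in>A. h x \<in> P" if "finite A" "prod h A \<in> P" for h :: "var set \<Rightarrow> 'k poly4" and A
    using that
  proof (induction A rule: finite_induct)
    case empty
    then show ?case using nP1 by simp
  next
    case (insert x A)
    then show ?case using P(1) by (auto simp: is_prime_ideal_def)
  qed
  \<comment> \<open>Otherwise a product of elements, one from each colon ideal but outside
    \<open>P\<close>, would lie in the intersection \<open>P\<close>, against primality.\<close>
  have "\<exists>V\<in>F. {g. g * f \<in> mspan (U V)} \<subseteq> P"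
  proof (rule ccontr)
    assume "\<not> ?thesis"
    then have "\<forall>V\<in>F. \<exists>g. g * f \<in> mspan (U V) \<and> g \<notin> P" by blast
    then obtain h where h: "\<And>V. V \<in> F \<Longrightarrow> h V * f \<in> mspan (U V) \<and> h V \<notin> P" by metis
    have "prod h F * f \<in> mspan (U V)" if "V \<in> F" for V
    proof -
      have "prod h F * f = prod h (F - {V}) * (h V * f)"
        using prod.remove[OF fin that, of h] by (simp add: mult_ac)
      then show ?thesis using is_idealD(3)[OF is_ideal_mspan[OF U(1)[OF that]]] h[OF that] by metis
    qed
    then have "prod h F \<in> P" unfolding eq by simp
    then show False using pp[OF fin] h by blast
  qed
  then obtain V where V: "V \<in> F" "P = {g. g * f \<in> mspan (U V)}" unfolding eq by blast
  have nf: "f \<notin> mspan (U V)"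
  proof
    assume "f \<in> mspan (U V)"
    then have "P = UNIV" unfolding V(2) using is_idealD(3)[OF is_ideal_mspan[OF U(1)[OF V(1)]]] by auto
    then show False using P(1) by (simp add: is_prime_ideal_def)
  qed
  have sub: "P \<subseteq> vprime V"
    using mspan_primary[OF U(1,2)[OF V(1) ]] V nf by blast
  have var: "monom (Poly_Mapping.single v 1) \<in> P" if "v \<in> V" for v
  proof -
    have pw: "monom (Poly_Mapping.single v n) \<in> P \<Longrightarrow> monom (Poly_Mapping.single v 1) \<in> P" for n
    proof (induction n)
      case 0
      then show ?case using nP1 by simp
    next
      case (Suc n)
      have "monom (Poly_Mapping.single v (Suc n)) =
          monom (Poly_Mapping.single v 1) * (monom (Poly_Mapping.single v n) :: 'k poly4)"
        by (simp add: mult_single flip: single_add)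
      then show ?case using Suc P(1) unfolding is_prime_ideal_def by metis
    qed
    have "monom (Poly_Mapping.single v N) * f \<in> mspan (U V)"
      using N[OF V(1) that] by (auto simp: mspan_def keys_monom_mult lookup_add)
    then have "monom (Poly_Mapping.single v N) \<in> P" by (simp add: V(2))
    then show ?thesis by (rule pw)
  qed
  have "vprime V \<subseteq> P"
  proof
    fix g :: "'k poly4" assume g: "g \<in> vprime V"
    have "(\<Sum>m\<in>Poly_Mapping.keys g. Poly_Mapping.single m (Poly_Mapping.lookup g m)) \<in> P"
    proof (rule ideal_sum_mem[OF I])
      fix m assume "m \<in> Poly_Mapping.keys g"
      then obtain v where v: "v \<in> V" "ex m v \<noteq> 0" using g by (auto simp: vprime_def mspan_def)
      have "m = (m - Poly_Mapping.single v 1) + Poly_Mapping.single v 1"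
        using v(2) by (intro poly_mapping_eqI) (auto simp: lookup_add lookup_minus lookup_single when_def)
      then have "Poly_Mapping.single m (Poly_Mapping.lookup g m) =
          Poly_Mapping.single (m - Poly_Mapping.single v 1) (Poly_Mapping.lookup g m) * monom (Poly_Mapping.single v 1)"
        by (simp add: mult_single)
      then show "Poly_Mapping.single m (Poly_Mapping.lookup g m) \<in> P"
        using is_idealD(3)[OF I var[OF v(1)]] by metis
    qed
    then show "g \<in> P" using poly_mapping_sum_single[of g] by simp
  qed
  with sub V(1) show "P \<in> vprime ` F" by auto
qed

section \<open>Koszul classes and depth\<close>

abbreviation X :: "var \<Rightarrow> 'k::field poly4" where
  "X v \<equiv> monom (Poly_Mapping.single v 1)"

definition nonzerodivisor_mod :: "'a::comm_ring_1 set \<Rightarrow> 'a \<Rightarrow> bool" where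
  "nonzerodivisor_mod N f \<longleftrightarrow> (\<forall>g. g * f \<in> N \<longrightarrow> g \<in> N)"

lemma ideal_sum_gen:
  assumes "is_ideal J" shows "ideal_sum J (ideal_gen S) = ideal_gen (J \<union> S)"
  unfolding ideal_sum_def
proof (rule ideal_gen_eqI)
  show "J \<union> ideal_gen S \<subseteq> ideal_gen (J \<union> S)"
    using ideal_gen_superset[of "J \<union> S"] ideal_gen_least[OF is_ideal_gen[of "J \<union> S"], of S] by blast
next
  fix K assume K: "is_ideal K" "J \<union> ideal_gen S \<subseteq> K"
  then show "ideal_gen (J \<union> S) \<subseteq> K"
    using ideal_gen_superset[of S] by (intro ideal_gen_least) auto
qed (rule is_ideal_gen)

lemma ideal_gen_ideal: "is_ideal J \<Longrightarrow> ideal_gen J = J"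
  by (rule ideal_gen_eqI) auto

lemma ideal_gen_insert: "ideal_gen (insert f S) = {a + r * f | a r. a \<in> ideal_gen S}"
proof (rule ideal_gen_eqI)
  note I = is_idealD[OF is_ideal_gen[of S]]
  let ?A = "{a + r * f | a r. a \<in> ideal_gen S}"
  have memI: "x \<in> ?A" if "a \<in> ideal_gen S" "x = a + r * f" for x a r using that by blast
  show "is_ideal ?A"
    unfolding is_ideal_def
  proof (intro conjI ballI allI)
    show "0 \<in> ?A" by (rule memI[of 0 _ 0]) (simp_all add: I(1))
  next
    fix x y assume "x \<in> ?A" "y \<in> ?A"
    then obtain a b r s where "x = a + r * f" "y = b + s * f" "a \<in> ideal_gen S" "b \<in> ideal_gen S" by blast
    then show "x + y \<in> ?A" using I(2)[of a b] by (intro memI[of "a + b" _ "r + s"]) (simp_all add: algebra_simps)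
  next
    fix t x assume "x \<in> ?A"
    then obtain a r where "x = a + r * f" "a \<in> ideal_gen S" by blast
    then show "t * x \<in> ?A"
      using I(3)[of a t] by (intro memI[of "t * a" _ "t * r"]) (simp_all add: algebra_simps)
  qed
  show "insert f S \<subseteq> ?A"
  proof (intro insert_subsetI subsetI)
    show "f \<in> ?A" by (rule memI[of 0 _ 1]) (simp_all add: I(1))
    show "x \<in> ?A" if "x \<in> S" for x
      using ideal_gen_superset[of S] that by (intro memI[of x _ 0]) auto
  qed
next
  fix J assume J: "is_ideal J" "insert f S \<subseteq> J"
  then have "ideal_gen S \<subseteq> J" by (intro ideal_gen_least) auto
  then show "{a + r * f | a r. a \<in> ideal_gen S} \<subseteq> J"
    using J(2) by (auto intro!: is_idealD(2,3)[OF J(1)])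
qed

lemma ideal_gen_insert_mem:
  assumes "a \<in> ideal_gen S" shows "a + r * f \<in> ideal_gen (insert f S)" "a + f * r \<in> ideal_gen (insert f S)"
  using assms unfolding ideal_gen_insert mult.commute[of f r] by blast+

text \<open>The next three predicates assert that the Koszul cohomology of the family \<open>x\<close> with values in
  the quotient by \<open>N\<close> is nonzero in degree 0, 1 and 2.\<close>

definition koszul0 :: "('i \<Rightarrow> 'a::comm_ring_1) \<Rightarrow> 'a set \<Rightarrow> bool" where
  "koszul0 x N \<longleftrightarrow> (\<exists>b. b \<notin> N \<and> (\<forall>i. x i * b \<in> N))"

definition koszul1 :: "('i \<Rightarrow> 'a::comm_ring_1) \<Rightarrow> 'a set \<Rightarrow> bool" where
  "koszul1 x N \<longleftrightarrow> (\<exists>a. (\<forall>i j. x i * a j - x j * a i \<in> N) \<and> (\<nexists>c. \<forall>i. a i - x i * c \<in> N))"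

definition koszul2 :: "('i \<Rightarrow> 'a::comm_ring_1) \<Rightarrow> 'a set \<Rightarrow> bool" where
  "koszul2 x N \<longleftrightarrow> (\<exists>a. (\<forall>i j k. x i * a j k - x j * a i k + x k * a i j \<in> N) \<and>
     (\<nexists>c. \<forall>i j. a i j - (x i * c j - x j * c i) \<in> N))"

text \<open>The contraction \<open>b\<close> satisfies \<open>x i * b = f * a i\<close> modulo the
  ideal: contraction and Koszul differential anticommute up to multiplication by \<open>f\<close>.
  If \<open>b\<close> were \<open>c * f\<close>, cancelling \<open>f\<close> would make
  \<open>a\<close> the coboundary of \<open>c\<close>.\<close>

lemma koszul1_step:
  fixes x :: "'i \<Rightarrow> 'a::comm_ring_1"
  assumes K: "koszul1 x (ideal_gen S)" and f: "f = (\<Sum>l\<in>L. x l * g l)"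
    and reg: "nonzerodivisor_mod (ideal_gen S) f"
  shows "koszul0 x (ideal_gen (insert f S))"
proof -
  note I = is_ideal_gen[of S]
  obtain a where a: "\<And>i j. x i * a j - x j * a i \<in> ideal_gen S" "\<And>c. \<exists>i. a i - x i * c \<notin> ideal_gen S"
    using K unfolding koszul1_def by blast
  define b where "b = (\<Sum>l\<in>L. g l * a l)"
  have xb: "x i * b - f * a i \<in> ideal_gen S" for i
  proof -
    have "x i * b - f * a i = (\<Sum>l\<in>L. g l * (x i * a l - x l * a i))"
      unfolding b_def f by (simp add: sum_distrib_left sum_distrib_right right_diff_distrib sum_subtractf mult_ac)
    also have "\<dots> \<in> ideal_gen S" by (rule ideal_sum_mem[OF I]) (rule is_idealD(3)[OF I a(1)])
    finally show ?thesis .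
  qed
  show ?thesis unfolding koszul0_def
  proof (intro exI conjI allI)
    show "x i * b \<in> ideal_gen (insert f S)" for i
      using ideal_gen_insert_mem(2)[OF xb[of i], of f "a i"] by simp
    show "b \<notin> ideal_gen (insert f S)"
    proof
      assume "b \<in> ideal_gen (insert f S)"
      then obtain n c where n: "b = n + c * f" "n \<in> ideal_gen S" unfolding ideal_gen_insert by blast
      have "(a i - x i * c) * f \<in> ideal_gen S" for i
      proof -
        have "(a i - x i * c) * f = x i * n - (x i * b - f * a i)"
          unfolding n(1) by (simp add: algebra_simps)
        also have "\<dots> \<in> ideal_gen S" by (rule is_idealD(6)[OF I is_idealD(3)[OF I n(2)] xb])
        finally show ?thesis .
      qed
      then show False using a(2) reg unfolding nonzerodivisor_mod_def by blast
    qed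
  qed
qed

text \<open>The same homotopy formula one degree up. If \<open>b\<close> were trivial, the
  coefficients \<open>r\<close> of \<open>f\<close> would form a cochain with coboundary
  \<open>a\<close>.\<close>

lemma koszul2_step:
  fixes x :: "'i \<Rightarrow> 'a::comm_ring_1"
  assumes K: "koszul2 x (ideal_gen S)" and f: "f = (\<Sum>l\<in>L. x l * g l)"
    and reg: "nonzerodivisor_mod (ideal_gen S) f"
  shows "koszul1 x (ideal_gen (insert f S))"
proof -
  note I = is_ideal_gen[of S]
  obtain a where a: "\<And>i j k. x i * a j k - x j * a i k + x k * a i j \<in> ideal_gen S"
      "\<And>c. \<exists>i j. a i j - (x i * c j - x j * c i) \<notin> ideal_gen S"
    using K unfolding koszul2_def by blast
  define b where "b j = (\<Sum>l\<in>L. g l * a l j)" for j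
  have xb: "x i * b j - x j * b i - f * a i j \<in> ideal_gen S" for i j
  proof -
    have "x i * b j - x j * b i - f * a i j = (\<Sum>l\<in>L. - g l * (x l * a i j - x i * a l j + x j * a l i))"
      unfolding b_def f
      by (simp add: sum_distrib_left sum_distrib_right algebra_simps flip: sum_subtractf sum.distrib)
    also have "\<dots> \<in> ideal_gen S" by (rule ideal_sum_mem[OF I]) (rule is_idealD(3)[OF I a(1)])
    finally show ?thesis .
  qed
  show ?thesis unfolding koszul1_def
  proof (intro exI[of _ b] conjI allI notI)
    show "x i * b j - x j * b i \<in> ideal_gen (insert f S)" for i j
      using ideal_gen_insert_mem(2)[OF xb[of i j], of f "a i j"] by simp
    assume "\<exists>c. \<forall>i. b i - x i * c \<in> ideal_gen (insert f S)"
    then obtain c where c: "\<And>i. b i - x i * c \<in> ideal_gen (insert f S)" by blast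
    have "\<exists>n r. b i = x i * c + n + r * f \<and> n \<in> ideal_gen S" for i
      using c[of i] unfolding ideal_gen_insert by (auto simp: algebra_simps)
    then obtain n r where nr: "\<And>i. b i = x i * c + n i + r i * f" "\<And>i. n i \<in> ideal_gen S"
      by metis
    have "(a i j - (x i * r j - x j * r i)) * f \<in> ideal_gen S" for i j
    proof -
      have "(a i j - (x i * r j - x j * r i)) * f = (x i * n j - x j * n i) - (x i * b j - x j * b i - f * a i j)"
        unfolding nr(1) by (simp add: algebra_simps)
      also have "\<dots> \<in> ideal_gen S"
        by (intro is_idealD(6)[OF I _ xb] is_idealD(6)[OF I] is_idealD(3)[OF I nr(2)])
      finally show ?thesis .
    qed
    then show False using a(2)[of r] reg unfolding nonzerodivisor_mod_def by blast
  qed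
qed

section \<open>Koszul classes of the variables bound the length of regular sequences\<close>

lemma graded_max_eq: "graded_max = (vprime UNIV :: 'k::field poly4 set)"
proof -
  have "(\<exists>v. ex m v \<noteq> 0) \<longleftrightarrow> m \<noteq> 0" for m by (metis lookup_zero poly_mapping_eqI)
  then show ?thesis
    by (auto simp: graded_max_def vprime_def mspan_def in_keys_iff)
qed

text \<open>Each monomial of \<open>f\<close> is divided by a variable occurring in it. The
  resulting \<open>g\<close> is what a Koszul class is contracted with.\<close>

lemma graded_max_linear_combination:
  assumes "f \<in> graded_max"
  obtains g :: "var \<Rightarrow> 'k::field poly4" where "f = (\<Sum>v\<in>UNIV. X v * g v)"
proof -
  let ?P = "\<lambda>f :: 'k poly4. \<exists>g. f = (\<Sum>v\<in>UNIV. X v * g v)"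
  have sum: "finite A \<Longrightarrow> (\<And>m. m \<in> A \<Longrightarrow> ?P (h m)) \<Longrightarrow> ?P (sum h A)" for h and A :: "(var \<Rightarrow>\<^sub>0 nat) set"
  proof (induction A rule: finite_induct)
    case empty then show ?case by (auto intro!: exI[of _ "\<lambda>_. 0"])
  next
    case (insert m A)
    obtain g where "h m = (\<Sum>v\<in>UNIV. X v * g v)" using insert.prems[of m] by auto
    moreover obtain g' where "sum h A = (\<Sum>v\<in>UNIV. X v * g' v)" using insert by auto
    ultimately have "sum h (insert m A) = (\<Sum>v\<in>UNIV. X v * (g v + g' v))"
      using insert.hyps by (simp add: sum.distrib distrib_left)
    then show ?case by (rule exI[of _ "\<lambda>v. g v + g' v"])
  qed
  have "?P (Poly_Mapping.single m (Poly_Mapping.lookup f m))" if "m \<in> Poly_Mapping.keys f" for m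
  proof -
    have "m \<in> {m. \<exists>v\<in>UNIV. ex m v \<noteq> 0}"
      using assms that unfolding graded_max_eq vprime_def mspan_def mem_Collect_eq[of f] by (rule subsetD)
    then obtain v where v: "ex m v \<noteq> 0" by blast
    let ?g = "Poly_Mapping.single (m - Poly_Mapping.single v 1) (Poly_Mapping.lookup f m)"
    have "m = Poly_Mapping.single v 1 + (m - Poly_Mapping.single v 1)"
      using v by (intro poly_mapping_eqI) (auto simp: lookup_add lookup_minus lookup_single when_def)
    then have "Poly_Mapping.single m (Poly_Mapping.lookup f m) = X v * ?g"
      by (simp add: mult_single)
    also have "\<dots> = (\<Sum>w\<in>UNIV. X w * (if w = v then ?g else 0))"
    proof -
      have "(\<Sum>w\<in>UNIV. X w * (if w = v then ?g else 0)) = (\<Sum>w\<in>UNIV. if w = v then X v * ?g else 0)"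
        by (rule sum.cong) auto
      then show ?thesis by simp
    qed
    finally show ?thesis by (rule exI[of _ "\<lambda>w. if w = v then ?g else 0"])
  qed
  from sum[OF finite_keys this]
  have "?P (\<Sum>m\<in>Poly_Mapping.keys f. Poly_Mapping.single m (Poly_Mapping.lookup f m))" .
  then have "?P f" by (subst poly_mapping_sum_single)
  then show ?thesis using that by (elim exE)
qed

lemma koszul0_not_nonzerodivisor:
  assumes "koszul0 X (ideal_gen S)" "f \<in> graded_max"
  shows "\<not> nonzerodivisor_mod (ideal_gen S) (f :: 'k::field poly4)"
proof -
  obtain b where b: "b \<notin> ideal_gen S" "\<And>i. X i * b \<in> ideal_gen S" using assms(1) by (auto simp: koszul0_def)
  obtain g where g: "f = (\<Sum>v\<in>UNIV. X v * g v)" using graded_max_linear_combination[OF assms(2)] .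
  have "b * f = (\<Sum>v\<in>UNIV. g v * (X v * b))"
    unfolding g by (simp add: sum_distrib_left mult_ac)
  also have "\<dots> \<in> ideal_gen S"
    by (intro ideal_sum_mem[OF is_ideal_gen] is_idealD(3)[OF is_ideal_gen] b)
  finally show ?thesis using b(1) unfolding nonzerodivisor_mod_def by blast
qed

lemma regular_seq_nth:
  assumes "regular_seq J fs" "is_ideal J" "i < length fs"
  shows "nonzerodivisor_mod (ideal_gen (J \<union> set (take i fs))) (fs ! i)" "fs ! i \<in> graded_max"
proof -
  show "nonzerodivisor_mod (ideal_gen (J \<union> set (take i fs))) (fs ! i)"
    using assms by (simp add: regular_seq_def nonzerodivisor_mod_def ideal_sum_gen)
  show "fs ! i \<in> graded_max"
    using assms(1) nth_mem[OF assms(3)] unfolding regular_seq_def by blast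
qed

lemma insert_set_take:
  "i < length fs \<Longrightarrow> J \<union> set (take (Suc i) fs) = insert (fs ! i) (J \<union> set (take i fs))"
  by (auto simp: take_Suc_conv_app_nth)

text \<open>A socle element is killed by the whole maximal ideal and stops the sequence. In the two
  lemmas that follow, each further element lowers the degree of the class by one.\<close>

lemma regular_seq_koszul0:
  assumes "regular_seq J fs" "is_ideal J" "koszul0 X (ideal_gen (J \<union> set (take i fs)))"
  shows "length fs \<le> i"
  using koszul0_not_nonzerodivisor[OF assms(3)] regular_seq_nth[OF assms(1,2), of i] by force

lemma regular_seq_koszul1:
  fixes J :: "'k::field poly4 set"
  assumes "regular_seq J fs" "is_ideal J" "koszul1 X (ideal_gen (J \<union> set (take i fs)))"
  shows "length fs \<le> Suc i"
proof (cases "i < length fs")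
  case True
  note r = regular_seq_nth[OF assms(1,2) True]
  obtain g where g: "fs ! i = (\<Sum>v\<in>UNIV. X v * g v)" using graded_max_linear_combination[OF r(2)] .
  from koszul1_step[OF assms(3) g r(1)]
  show ?thesis using regular_seq_koszul0[OF assms(1,2), of "Suc i"] by (simp add: insert_set_take True)
qed simp

lemma regular_seq_koszul2:
  fixes J :: "'k::field poly4 set"
  assumes "regular_seq J fs" "is_ideal J" "koszul2 X (ideal_gen (J \<union> set (take i fs)))"
  shows "length fs \<le> Suc (Suc i)"
proof (cases "i < length fs")
  case True
  note r = regular_seq_nth[OF assms(1,2) True]
  obtain g where g: "fs ! i = (\<Sum>v\<in>UNIV. X v * g v)" using graded_max_linear_combination[OF r(2)] .
  from koszul2_step[OF assms(3) g r(1)]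
  show ?thesis using regular_seq_koszul1[OF assms(1,2), of "Suc i"] by (simp add: insert_set_take True)
qed simp

lemma depth_quot_le:
  assumes "\<And>fs. regular_seq J fs \<Longrightarrow> length fs \<le> n" shows "depth_quot J \<le> n"
\<comment> \<open>On \<open>nat\<close> the supremum of the empty set is 0; the general bound asks
  for a nonempty set.\<close>
proof (cases "{length fs |fs. regular_seq J fs} = {}")
  case True then show ?thesis by (simp add: depth_quot_def)
next
  case False
  then show ?thesis unfolding depth_quot_def using assms by (intro cSup_least) auto
qed

lemma depth_quot_ge:
  assumes "\<And>fs. regular_seq J fs \<Longrightarrow> length fs \<le> n" "regular_seq J fs" shows "length fs \<le> depth_quot J"
  unfolding depth_quot_def using assms by (intro cSup_upper) (auto simp: bdd_above_def)

section \<open>Two families of monomial ideals\<close>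

definition mon :: "nat \<Rightarrow> nat \<Rightarrow> nat \<Rightarrow> nat \<Rightarrow> (var \<Rightarrow>\<^sub>0 nat)" where
  "mon a b c d = Poly_Mapping.single Vx a + Poly_Mapping.single Vy b + Poly_Mapping.single Vz c + Poly_Mapping.single Vu d"

lemma ex_mon [simp]: "ex (mon a b c d) Vx = a" "ex (mon a b c d) Vy = b"
    "ex (mon a b c d) Vz = c" "ex (mon a b c d) Vu = d"
  by (auto simp: mon_def lookup_add lookup_single when_def)

lemma ex_single [simp]: "ex (Poly_Mapping.single v n) w = (if v = w then n else 0)"
  by (auto simp: lookup_single when_def)

text \<open>Exponents of \<open>Q\<^sup>k\<close>: the generators of \<open>Q\<close> are \<open>x\<^sup>i y\<^bsup>D-i\<^esup>\<close> with \<open>i = t + e * s\<close> and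
  \<open>s, t \<in> {0, 1}\<close>.\<close>

definition gapped :: "nat \<Rightarrow> nat \<Rightarrow> nat \<Rightarrow> nat \<Rightarrow> bool" where
  "gapped e k a b \<longleftrightarrow> (\<exists>s\<le>k. \<exists>t\<le>k. t + e * s \<le> a \<and> (e + 1) * k \<le> b + (t + e * s))"

lemma gapped_mono: "gapped e k a b \<Longrightarrow> a \<le> a' \<Longrightarrow> b \<le> b' \<Longrightarrow> gapped e k a' b'"
  unfolding gapped_def by (meson add_le_mono1 order_trans)

lemma gapped_add:
  assumes "gapped e k a b" "gapped e l a' b'" shows "gapped e (k + l) (a + a') (b + b')"
proof -
  obtain s t s' t' where "s \<le> k" "t \<le> k" "t + e * s \<le> a" "(e + 1) * k \<le> b + (t + e * s)"
    "s' \<le> l" "t' \<le> l" "t' + e * s' \<le> a'" "(e + 1) * l \<le> b' + (t' + e * s')"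
    using assms unfolding gapped_def by blast
  then show ?thesis unfolding gapped_def
    by (intro exI[of _ "s + s'"] conjI exI[of _ "t + t'"]) (auto simp: algebra_simps)
qed

lemma gapped_degree: "gapped e k a b \<Longrightarrow> (e + 1) * k \<le> a + b"
  unfolding gapped_def by auto

lemma gapped_0 [simp]: "gapped e 0 a b"
  by (simp add: gapped_def)

lemma gapped_top: "(e + 1) * k \<le> a \<Longrightarrow> gapped e k a b"
  unfolding gapped_def by (intro exI[of _ k]) (auto simp: algebra_simps)

lemma gapped_bot: "(e + 1) * k \<le> b \<Longrightarrow> gapped e k a b"
  unfolding gapped_def by (intro exI[of _ 0]) (auto simp: algebra_simps)

text \<open>\<open>s\<close> and \<open>t\<close> split independently into a part at most 1 and a
  part at most \<open>k\<close>, which separates off one generator of \<open>Q\<close>. The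
  exponents of \<open>y\<close> are the complements in degree.\<close>

lemma gapped_split:
  assumes "gapped e (Suc k) a b"
  obtains i1 j1 i2 j2 where "i1 + j1 = e + 1" "i2 + j2 = (e + 1) * k" "i1 + i2 \<le> a" "j1 + j2 \<le> b"
    "gapped e 1 i1 j1" "gapped e k i2 j2"
proof -
  obtain s t where st: "s \<le> Suc k" "t \<le> Suc k" "t + e * s \<le> a" "(e + 1) * Suc k \<le> b + (t + e * s)"
    using assms unfolding gapped_def by blast
  obtain s1 s2 where s: "s = s1 + s2" "s1 \<le> 1" "s2 \<le> k" using st(1)
    by (metis add.commute add_0 le_Suc_eq le_add1 le_refl plus_1_eq_Suc zero_le)
  obtain t1 t2 where t: "t = t1 + t2" "t1 \<le> 1" "t2 \<le> k" using st(2)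
    by (metis add.commute add_0 le_Suc_eq le_add1 le_refl plus_1_eq_Suc zero_le)
  have 1: "t1 + e * s1 \<le> e + 1" "t2 + e * s2 \<le> (e + 1) * k"
    using s t mult_le_mono2[OF s(2), of e] mult_le_mono2[OF s(3), of e]
    unfolding add_mult_distrib by linarith+
  show thesis
  proof (rule that)
    show "t1 + e * s1 + (e + 1 - (t1 + e * s1)) = e + 1"
      "t2 + e * s2 + ((e + 1) * k - (t2 + e * s2)) = (e + 1) * k" using 1 by auto
    show "t1 + e * s1 + (t2 + e * s2) \<le> a"
      "e + 1 - (t1 + e * s1) + ((e + 1) * k - (t2 + e * s2)) \<le> b"
      using st(3,4) s t 1 by (auto simp: algebra_simps)
    show "gapped e 1 (t1 + e * s1) (e + 1 - (t1 + e * s1))"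
      "gapped e k (t2 + e * s2) ((e + 1) * k - (t2 + e * s2))"
      using s t 1 unfolding gapped_def by fastforce+
  qed
qed

text \<open>The missing exponents lie between \<open>e * s + k\<close> and
  \<open>e * (s + 1)\<close>. From \<open>k = e - 1\<close> on, every remainder modulo
  \<open>e\<close> is an admissible \<open>t\<close>, so none are missing.\<close>

lemma gapped_stable:
  assumes "1 < e" "e - 1 \<le> k" shows "gapped e k a b \<longleftrightarrow> (e + 1) * k \<le> a + b"
proof
  assume ab: "(e + 1) * k \<le> a + b"
  define i where "i = min a ((e + 1) * k)"
  have "\<exists>s\<le>k. \<exists>t\<le>k. t + e * s = i"
  proof (cases "i div e \<le> k")
    case True
    have "i mod e < e" using assms(1) by simp
    then have "i mod e \<le> k" using assms(2) by linarith
    then show ?thesis using True mod_mult_div_eq[of i e] by blast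
  next
    \<comment> \<open>The cap on \<open>i\<close> leaves a remainder of at most \<open>k\<close>
      over \<open>s = k\<close>.\<close>
    case False
    then have "e * k \<le> e * (i div e)" by (intro mult_le_mono2) simp
    also have "\<dots> \<le> i" by (rule times_div_less_eq_dividend)
    finally have "e * k \<le> i" .
    moreover have "i \<le> e * k + k" by (simp add: i_def)
    ultimately show ?thesis by (intro exI[of _ k] conjI exI[of _ "i - e * k"]) auto
  qed
  moreover have "i \<le> a" "(e + 1) * k \<le> b + i" using ab unfolding i_def by linarith+
  ultimately show "gapped e k a b" unfolding gapped_def by metis
qed (rule gapped_degree)

lemma interval_split:
  fixes x :: nat
  assumes "l1 \<le> u1" "l2 \<le> u2" "l1 + l2 \<le> x" "x \<le> u1 + u2"
  obtains x1 x2 where "x = x1 + x2" "l1 \<le> x1" "x1 \<le> u1" "l2 \<le> x2" "x2 \<le> u2"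
  by (rule that[of "max l1 (x - u2)" "x - max l1 (x - u2)"]) (use assms in linarith)+

text \<open>Exponents of \<open>Q\<^sup>k \<inter> (z, u)\<^bsup>Dk\<^esup> \<inter> (x, u)\<^bsup>Dk\<^esup> \<inter> (y, z)\<^bsup>Dk\<^esup>\<close>.\<close>

definition cyc :: "nat \<Rightarrow> nat \<Rightarrow> nat \<Rightarrow> nat \<Rightarrow> nat \<Rightarrow> nat \<Rightarrow> bool" where
  "cyc e k a b c d \<longleftrightarrow> gapped e k a b \<and> (e + 1) * k \<le> c + d \<and> (e + 1) * k \<le> a + d \<and> (e + 1) * k \<le> b + c"

text \<open>The exponents of \<open>x\<close> and \<open>y\<close> are split along \<open>Q\<close>
  first. The conditions on the other edges of the 4-cycle x, y, z, u are mere interval constraints,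
  met by dividing \<open>z\<close> and then \<open>u\<close>.\<close>

lemma cyc_split:
  assumes "cyc e (Suc k) a b c d"
  obtains a1 b1 c1 d1 where "a1 \<le> a" "b1 \<le> b" "c1 \<le> c" "d1 \<le> d" "cyc e 1 a1 b1 c1 d1"
    "cyc e k (a - a1) (b - b1) (c - c1) (d - d1)"
proof -
  define D P where "D = e + 1" and "P = (e + 1) * k"
  have DP: "(e + 1) * Suc k = D + P" by (simp add: D_def P_def)
  obtain i1 j1 i2 j2 where ij: "i1 + j1 = D" "i2 + j2 = P" "i1 + i2 \<le> a" "j1 + j2 \<le> b"
    "gapped e 1 i1 j1" "gapped e k i2 j2"
    using assms unfolding cyc_def D_def P_def by (elim conjE gapped_split)
  have A: "D + P \<le> c + d" "D + P \<le> a + d" "D + P \<le> b + c" using assms unfolding cyc_def DP by auto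
  \<comment> \<open>The cap makes first summands of at most \<open>D\<close> and second summands of
    at most \<open>P\<close> possible, and keeps the inequalities.\<close>
  define a' b' where "a' = min a (D + P)" and "b' = min b (D + P)"
  have ab': "a' \<le> a" "b' \<le> b" "i1 + i2 \<le> a'" "j1 + j2 \<le> b'" "a' \<le> D + P" "b' \<le> D + P"
    "D + P \<le> a' + d" "D + P \<le> b' + c"
    using ij(1-4) A unfolding a'_def b'_def by linarith+
  obtain a1 a2 where a: "a' = a1 + a2" "i1 \<le> a1" "a1 \<le> D" "i2 \<le> a2" "a2 \<le> P"
    by (rule interval_split[of i1 D i2 P a']) (use ij(1-4) ab' in linarith)+
  obtain b1 b2 where b: "b' = b1 + b2" "j1 \<le> b1" "b1 \<le> D" "j2 \<le> b2" "b2 \<le> P"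
    by (rule interval_split[of j1 D j2 P b']) (use ij(1-4) ab' in linarith)+
  \<comment> \<open>The least exponent of \<open>z\<close> compatible with \<open>b'\<close> and
    \<open>d\<close>. With \<open>c1\<close> between \<open>D - b1\<close> and \<open>a1\<close>,
    the choice \<open>d1 = D - c1\<close> satisfies the first factor; all surplus goes to the
    second.\<close>
  define c' where "c' = max (D + P - b') (D + P - d)"
  have c': "c' \<le> c" "D + P \<le> c' + d" "D + P \<le> c' + b'" "c' \<le> a'"
    using ij(1-4) A ab' unfolding c'_def by linarith+
  obtain c1 c2 where c: "c' = c1 + c2" "D - b1 \<le> c1" "c1 \<le> a1" "P - b2 \<le> c2" "c2 \<le> a2"
    by (rule interval_split[of "D - b1" a1 "P - b2" a2 c']) (use ij(1-4) c' a b in linarith)+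
  show thesis
  proof (rule that)
    define d1 a2' b2' c2' d2' where "d1 = D - c1" and "a2' = a - a1" and "b2' = b - b1"
      and "c2' = c - c1" and "d2' = d - d1"
    have "c1 \<le> D" using c(3) a(3) by (rule order_trans)
    then have r1: "c1 + d1 = D" by (simp add: d1_def)
    show le: "a1 \<le> a" "b1 \<le> b" "c1 \<le> c" "d1 \<le> d"
      using a(1) b(1) c(1,5) a(5) c'(1,2) ab'(1,2) r1 by linarith+
    have r: "c1 + d1 = D" "a1 + a2' = a" "b1 + b2' = b" "c1 + c2' = c" "d1 + d2' = d"
      using le r1 by (simp_all add: a2'_def b2'_def c2'_def d2'_def)
    have "gapped e 1 a1 b1" by (rule gapped_mono[OF ij(5)]) (use a b in linarith)+
    moreover have "D \<le> c1 + d1" "D \<le> a1 + d1" "D \<le> b1 + c1" using b c r by linarith+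
    ultimately show "cyc e 1 a1 b1 c1 d1" by (simp add: cyc_def D_def)
    have "i2 \<le> a2'" "j2 \<le> b2'" using r a b ab' by linarith+
    then have "gapped e k a2' b2'" by (rule gapped_mono[OF ij(6)])
    moreover have "P \<le> c2' + d2'" "P \<le> a2' + d2'" "P \<le> b2' + c2'" using a b c c' ab' r by linarith+
    ultimately show "cyc e k (a - a1) (b - b1) (c - c1) (d - d1)"
      unfolding a2'_def b2'_def c2'_def d2'_def by (simp add: cyc_def P_def)
  qed
qed

text \<open>Exponents of \<open>(x, y)\<^bsup>Dk\<^esup> \<inter> m\<^bsup>(D+1)k\<^esup> \<inter> (Q\<^sup>k, z)\<close>, the \<open>k\<close>-th power of
  \<open>Q m + z (x, y)\<^sup>D\<close>.\<close>

definition emb :: "nat \<Rightarrow> nat \<Rightarrow> nat \<Rightarrow> nat \<Rightarrow> nat \<Rightarrow> nat \<Rightarrow> bool" where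
  "emb e k a b c d \<longleftrightarrow> (e + 1) * k \<le> a + b \<and> (e + 2) * k \<le> a + b + c + d \<and> (gapped e k a b \<or> 1 \<le> c)"

lemma unit_split:
  fixes a :: nat
  assumes "0 < a + b + c + d"
  obtains a1 b1 c1 d1 where "a1 + b1 + c1 + d1 = 1" "a1 \<le> a" "b1 \<le> b" "c1 \<le> c" "d1 \<le> d"
proof -
  consider "0 < a" | "0 < b" | "0 < c" | "0 < d" using assms by linarith
  then show ?thesis
    by cases (use that[of 1 0 0 0] that[of 0 1 0 0] that[of 0 0 1 0] that[of 0 0 0 1] in auto)
qed

text \<open>Outside the gaps the \<open>Q\<close>-part is split and spare degree yields the factor
  from the maximal ideal. In a gap some \<open>z\<close> is present; kept in the second factor, it
  frees that factor from the gap condition.\<close>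

lemma emb_split:
  assumes "emb e (Suc k) a b c d"
  obtains a1 b1 c1 d1 where "a1 \<le> a" "b1 \<le> b" "c1 \<le> c" "d1 \<le> d" "emb e 1 a1 b1 c1 d1"
    "emb e k (a - a1) (b - b1) (c - c1) (d - d1)"
proof -
  define D P where "D = e + 1" and "P = (e + 1) * k"
  have DP: "(e + 1) * Suc k = D + P" "(e + 2) * Suc k = D + 1 + P + k" "(e + 2) * k = P + k"
    "(e + 2) * 1 = D + 1"
    by (simp_all add: D_def P_def)
  have A: "D + P \<le> a + b" "D + 1 + P + k \<le> a + b + c + d" using assms unfolding emb_def DP by auto
  show thesis
  proof (cases "gapped e (Suc k) a b")
    case True
    obtain i1 j1 i2 j2 where ij: "i1 + j1 = D" "i2 + j2 = P" "i1 + i2 \<le> a" "j1 + j2 \<le> b"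
      "gapped e 1 i1 j1" "gapped e k i2 j2"
      using True unfolding D_def P_def by (elim gapped_split)
    obtain p q r s where u: "p + q + r + s = 1" "p \<le> a - (i1 + i2)" "q \<le> b - (j1 + j2)" "r \<le> c" "s \<le> d"
      by (rule unit_split[of "a - (i1 + i2)" "b - (j1 + j2)" c d]) (use A ij in auto)
    show thesis
    proof (rule that)
      show "i1 + p \<le> a" "j1 + q \<le> b" "r \<le> c" "s \<le> d" using u ij by auto
      have "gapped e 1 (i1 + p) (j1 + q)" by (rule gapped_mono[OF ij(5)]) auto
      then show "emb e 1 (i1 + p) (j1 + q) r s"
        using u ij unfolding emb_def DP by (auto simp: D_def)
      define a' b' c' d' where "a' = a - (i1 + p)" and "b' = b - (j1 + q)" and "c' = c - r" and "d' = d - s"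
      have e: "i1 + p + a' = a" "j1 + q + b' = b" "r + c' = c" "s + d' = d" "i2 \<le> a'" "j2 \<le> b'"
        using u ij(1-4) unfolding a'_def b'_def c'_def d'_def by linarith+
      then have "P \<le> a' + b'" "P + k \<le> a' + b' + c' + d'" using A u(1) ij(1-4) by linarith+
      moreover have "gapped e k a' b'" by (rule gapped_mono[OF ij(6) e(5,6)])
      ultimately show "emb e k (a - (i1 + p)) (b - (j1 + q)) (c - r) (d - s)"
        unfolding emb_def DP P_def[symmetric] a'_def[symmetric] b'_def[symmetric] c'_def[symmetric] d'_def[symmetric]
        by simp
    qed
  next
    case False
    then have c: "1 \<le> c" using assms by (simp add: emb_def)
    show thesis
    proof (cases "k = 0")
      case True
      show thesis
        by (rule that[of a b c d]) (use assms True in \<open>auto simp: emb_def\<close>)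
    next
      case k: False
      have PD: "D \<le> P" unfolding D_def P_def using k by (cases k) auto
      \<comment> \<open>A pure power x^D or y^D always lies in \<open>Q\<close>, and one of them
        fits since \<open>a + b\<close> is at least \<open>D + P\<close>, hence at least twice
        \<open>D\<close>.\<close>
      obtain i j where ij: "i + j = D" "i \<le> a" "j \<le> b" "i = 0 \<or> j = 0"
      proof (cases "D \<le> a")
        case True then show ?thesis by (intro that[of D 0]) auto
      next
        case False then show ?thesis using A(1) PD by (intro that[of 0 D]) auto
      qed
      have g: "gapped e 1 i j" using ij gapped_top[of e 1 i j] gapped_bot[of e 1 j i] by (auto simp: D_def)
      \<comment> \<open>The additional variable comes from \<open>x\<close> or \<open>y\<close> if
        their degree exceeds \<open>D + P\<close>, otherwise from \<open>z\<close> or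
        \<open>u\<close>; one \<open>z\<close> is always spared.\<close>
      obtain p q r s where u: "p + q + r + s = 1" "p + q + D + P \<le> a + b" "p + i \<le> a" "q + j \<le> b" "r + 1 \<le> c" "s \<le> d"
      proof (cases "a + b = D + P")
        case True
        obtain p q r s where "p + q + r + s = 1" "p \<le> 0" "q \<le> 0" "r \<le> c - 1" "s \<le> d"
          by (rule unit_split[of 0 0 "c - 1" d]) (use A c k True in auto)
        then show ?thesis using True c ij(2,3) by (intro that[of p q r s]) simp_all
      next
        case False
        then have lt: "D + P < a + b" using A(1) by linarith
        then have "0 < (a - i) + (b - j) + 0 + 0" using ij(1) by linarith
        then obtain p q r s where "p + q + r + s = 1" "p \<le> a - i" "q \<le> b - j" "r \<le> 0" "s \<le> 0"
          by (rule unit_split)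
        then show ?thesis using lt ij(2,3) c by (intro that[of p q r s]) linarith+
      qed
      show thesis
      proof (rule that)
        show le: "i + p \<le> a" "j + q \<le> b" "r \<le> c" "s \<le> d" using u by linarith+
        have "gapped e 1 (i + p) (j + q)" by (rule gapped_mono[OF g]) auto
        then show "emb e 1 (i + p) (j + q) r s"
          using u(1) ij(1) D_def unfolding emb_def mult_1_right by (intro conjI disjI1) (assumption | linarith)+
        define a' b' c' d' where "a' = a - (i + p)" and "b' = b - (j + q)" and "c' = c - r" and "d' = d - s"
        have "i + p + a' = a" "j + q + b' = b" "r + c' = c" "s + d' = d" "1 \<le> c'"
          using u(5) le unfolding a'_def b'_def c'_def d'_def by simp_all
        moreover from this have "P \<le> a' + b'" "P + k \<le> a' + b' + c' + d'" using A u(1,2) ij(1) by linarith+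
        ultimately show "emb e k (a - (i + p)) (b - (j + q)) (c - r) (d - s)"
          unfolding emb_def DP P_def[symmetric] a'_def[symmetric] b'_def[symmetric] c'_def[symmetric] d'_def[symmetric]
          by simp
      qed
    qed
  qed
qed

section \<open>Exponent sets of the powers of the two ideals\<close>

definition cycle_exps :: "nat \<Rightarrow> nat \<Rightarrow> (var \<Rightarrow>\<^sub>0 nat) set" where
  "cycle_exps e k = {m. cyc e k (ex m Vx) (ex m Vy) (ex m Vz) (ex m Vu)}"

definition embedded_exps :: "nat \<Rightarrow> nat \<Rightarrow> (var \<Rightarrow>\<^sub>0 nat) set" where
  "embedded_exps e k = {m. emb e k (ex m Vx) (ex m Vy) (ex m Vz) (ex m Vu)}"

lemma upset_cycle_exps: "upset (cycle_exps e k)"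
  by (auto simp: upset_def cycle_exps_def cyc_def lookup_add intro: gapped_mono)

lemma upset_embedded_exps: "upset (embedded_exps e k)"
  by (auto simp: upset_def embedded_exps_def emb_def lookup_add intro: gapped_mono)

lemma mon_add_diff:
  assumes "a \<le> ex m Vx" "b \<le> ex m Vy" "c \<le> ex m Vz" "d \<le> ex m Vu"
  shows "m = mon a b c d + (m - mon a b c d)"
  by (rule monom_eqI) (use assms in \<open>simp_all add: lookup_add lookup_minus\<close>)

lemma cycle_exps_Suc: "cycle_exps e (Suc k) = {a + b |a b. a \<in> cycle_exps e 1 \<and> b \<in> cycle_exps e k}"
proof (intro equalityI subsetI)
  fix m assume "m \<in> cycle_exps e (Suc k)"
  then obtain a b c d where "a \<le> ex m Vx" "b \<le> ex m Vy" "c \<le> ex m Vz" "d \<le> ex m Vu"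
    "cyc e 1 a b c d" "cyc e k (ex m Vx - a) (ex m Vy - b) (ex m Vz - c) (ex m Vu - d)"
    unfolding cycle_exps_def mem_Collect_eq by (rule cyc_split)
  then show "m \<in> {a + b |a b. a \<in> cycle_exps e 1 \<and> b \<in> cycle_exps e k}"
    using mon_add_diff[of a m b c d] by (force simp: cycle_exps_def lookup_minus)
next
  fix m assume "m \<in> {a + b |a b. a \<in> cycle_exps e 1 \<and> b \<in> cycle_exps e k}"
  then show "m \<in> cycle_exps e (Suc k)"
    using gapped_add[of e 1 _ _ k] by (auto simp: cycle_exps_def cyc_def lookup_add)
qed

lemma embedded_exps_Suc:
  "embedded_exps e (Suc k) = {a + b |a b. a \<in> embedded_exps e 1 \<and> b \<in> embedded_exps e k}"
proof (intro equalityI subsetI)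
  fix m assume "m \<in> embedded_exps e (Suc k)"
  then obtain a b c d where "a \<le> ex m Vx" "b \<le> ex m Vy" "c \<le> ex m Vz" "d \<le> ex m Vu"
    "emb e 1 a b c d" "emb e k (ex m Vx - a) (ex m Vy - b) (ex m Vz - c) (ex m Vu - d)"
    unfolding embedded_exps_def mem_Collect_eq by (rule emb_split)
  then show "m \<in> {a + b |a b. a \<in> embedded_exps e 1 \<and> b \<in> embedded_exps e k}"
    using mon_add_diff[of a m b c d] by (force simp: embedded_exps_def lookup_minus)
next
  fix m assume "m \<in> {a + b |a b. a \<in> embedded_exps e 1 \<and> b \<in> embedded_exps e k}"
  then show "m \<in> embedded_exps e (Suc k)"
    using gapped_add[of e 1 _ _ k] by (auto simp: embedded_exps_def emb_def lookup_add)
qed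

lemma ideal_pow_cycle: "ideal_pow (mspan (cycle_exps e 1)) k = (mspan (cycle_exps e k) :: 'k::field poly4 set)"
  by (rule ideal_pow_mspan[OF upset_cycle_exps _ cycle_exps_Suc]) (auto simp: cycle_exps_def cyc_def)

lemma ideal_pow_embedded:
  "ideal_pow (mspan (embedded_exps e 1)) k = (mspan (embedded_exps e k) :: 'k::field poly4 set)"
  by (rule ideal_pow_mspan[OF upset_embedded_exps _ embedded_exps_Suc]) (auto simp: embedded_exps_def emb_def)

section \<open>Associated primes of the powers\<close>

lemma gapped_i0: "1 \<le> k \<Longrightarrow> e \<le> a \<Longrightarrow> (e + 1) * k \<le> b + e \<Longrightarrow> gapped e k a b"
  unfolding gapped_def by (intro exI[of _ 1] conjI exI[of _ 0]) simp_all

lemma gapped_i1: "t \<le> k \<Longrightarrow> t \<le> a \<Longrightarrow> (e + 1) * k \<le> b + t \<Longrightarrow> gapped e k a b"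
  unfolding gapped_def by (intro exI[of _ 0] conjI exI[of _ t]) simp_all

text \<open>Below \<open>e\<close> only \<open>s = 0\<close> is possible, so at most
  \<open>x^k\<close> is used and \<open>b\<close> is too small. This is the first gap;
  \<open>gapped_i1\<close> with \<open>t = k\<close> and \<open>gapped_i0\<close> are its two
  borders.\<close>

lemma not_gapped:
  assumes "a < e" "b + k < (e + 1) * k" shows "\<not> gapped e k a b"
proof
  assume "gapped e k a b"
  then obtain s t where st: "t \<le> k" "t + e * s \<le> a" "(e + 1) * k \<le> b + (t + e * s)"
    unfolding gapped_def by blast
  show False
  proof (cases s)
    case 0 then show False using st assms by simp
  next
    case (Suc r) then show False using st(2) assms(1) by simp
  qed
qed

text \<open>The four components are primary to the four edge primes for every \<open>k\<close>. None
  is redundant, as monomials just outside one component and inside the others show.\<close>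

lemma Ass_cycle:
  assumes k: "1 \<le> k"
  shows "Ass (mspan (cycle_exps e k)) =
    (vprime ` {{Vx, Vy}, {Vz, Vu}, {Vx, Vu}, {Vy, Vz}} :: 'k::field poly4 set set)"
proof
  let ?F = "{{Vx, Vy}, {Vz, Vu}, {Vx, Vu}, {Vy, Vz}}"
  define P where "P = (e + 1) * k"
  define U where "U V = (if Vz \<notin> V \<and> Vu \<notin> V then {m. gapped e k (ex m Vx) (ex m Vy)}
    else {m. P \<le> (\<Sum>v\<in>V. ex m v)})" for V
  have P1: "1 \<le> P" using k by (simp add: P_def)
  show "Ass (mspan (cycle_exps e k)) \<subseteq> (vprime ` ?F :: 'k poly4 set set)"
  proof (rule Ass_mspan_subset[where U = U and N = P])
    show "cycle_exps e k = (\<Inter>V\<in>?F. U V)"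
      by (auto simp: U_def cycle_exps_def cyc_def P_def)
    show "upset (U V)" if "V \<in> ?F" for V
      using that by (auto simp: U_def upset_def lookup_add intro: gapped_mono)
    show "depends_on V (U V)" if "V \<in> ?F" for V
      using that by (auto simp: U_def depends_on_def)
    show "m \<in> U V" if "V \<in> ?F" "v \<in> V" "P \<le> ex m v" for V v m
      using that gapped_top[of e k "ex m Vx" "ex m Vy"] gapped_bot[of e k "ex m Vy" "ex m Vx"]
      by (auto simp: U_def P_def)
  qed simp
  have mem: "m \<in> cycle_exps e k \<longleftrightarrow> gapped e k (ex m Vx) (ex m Vy) \<and> P \<le> ex m Vz + ex m Vu \<and>
      P \<le> ex m Vx + ex m Vu \<and> P \<le> ex m Vy + ex m Vz" for m
    by (simp add: cycle_exps_def cyc_def P_def)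
  note top = gapped_top[of e k, folded P_def] and bot = gapped_bot[of e k, folded P_def]
  have 1: "vprime {Vz, Vu} \<in> Ass (mspan (cycle_exps e k) :: 'k poly4 set)"
    by (rule vprime_in_Ass[where p = "mon P P (P - 1) 0"])
       (use P1 in \<open>auto simp: mem lookup_add top\<close>)
  have 2: "vprime {Vx, Vu} \<in> Ass (mspan (cycle_exps e k) :: 'k poly4 set)"
    by (rule vprime_in_Ass[where p = "mon (P - 1) P P 0"])
       (use P1 in \<open>auto simp: mem lookup_add bot\<close>)
  have 3: "vprime {Vy, Vz} \<in> Ass (mspan (cycle_exps e k) :: 'k poly4 set)"
    by (rule vprime_in_Ass[where p = "mon P (P - 1) 0 P"])
       (use P1 in \<open>auto simp: mem lookup_add top\<close>)
  \<comment> \<open>The exponents 0 and 1 of \<open>x\<close> both occur among the generators of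
    \<open>Q^k\<close>, so y^(P-1) enters after multiplication by \<open>x\<close> or
    \<open>y\<close> whatever the gaps.\<close>
  have g: "gapped e k x (y + (P - 1)) \<longleftrightarrow> x \<noteq> 0 \<or> y \<noteq> 0" for x y
  proof
    show "x \<noteq> 0 \<or> y \<noteq> 0" if "gapped e k x (y + (P - 1))"
      using gapped_degree[OF that] P1 unfolding P_def[symmetric] by linarith
    show "gapped e k x (y + (P - 1))" if "x \<noteq> 0 \<or> y \<noteq> 0"
      using that gapped_bot[of e k "y + (P - 1)" x] gapped_i1[of 1 k x e "y + (P - 1)"] k P1
      unfolding P_def[symmetric] by linarith
  qed
  have 4: "vprime {Vx, Vy} \<in> Ass (mspan (cycle_exps e k) :: 'k poly4 set)"
    by (rule vprime_in_Ass[where p = "mon 0 (P - 1) P P"])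
       (auto simp: mem lookup_add g[simplified])
  show "vprime ` ?F \<subseteq> Ass (mspan (cycle_exps e k) :: 'k poly4 set)"
    using 1 2 3 4 by blast
qed

text \<open>With the gaps closed, the third condition of \<open>emb\<close> follows from the first.
  What remains is the intersection of a power of (x, y) with a power of the maximal ideal.\<close>

lemma Ass_embedded_stable:
  assumes e: "1 < e" "e - 1 \<le> k"
  shows "Ass (mspan (embedded_exps e k)) = (vprime ` {{Vx, Vy}, UNIV} :: 'k::field poly4 set set)"
proof
  let ?F = "{{Vx, Vy}, UNIV}"
  define P where "P = (e + 1) * k"
  define U where "U V = {m. (if Vz \<in> V then P + k else P) \<le> (\<Sum>v\<in>V. ex m v)}" for V
  have k: "1 \<le> k" "1 \<le> P" using e by (auto simp: P_def)
  have P2: "(e + 2) * k = P + k" by (simp add: P_def)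
  note g = gapped_stable[OF e, folded P_def]
  show "Ass (mspan (embedded_exps e k)) \<subseteq> (vprime ` ?F :: 'k poly4 set set)"
  proof (rule Ass_mspan_subset[where U = U and N = "P + k"])
    show "embedded_exps e k = (\<Inter>V\<in>?F. U V)"
      unfolding embedded_exps_def emb_def g P2 P_def[symmetric] by (auto simp: U_def UNIV_var)
    show "upset (U V)" if "V \<in> ?F" for V
      using that by (auto simp: U_def upset_def lookup_add sum.distrib)
    show "depends_on V (U V)" if "V \<in> ?F" for V
      using that by (auto simp: U_def depends_on_def)
    show "m \<in> U V" if "V \<in> ?F" "v \<in> V" "P + k \<le> ex m v" for V v m
      using that(3) member_le_sum[OF that(2), of "ex m"] by (auto simp: U_def)
  qed simp
  have mem: "m \<in> embedded_exps e k \<longleftrightarrow> P \<le> ex m Vx + ex m Vy \<and>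
      P + k \<le> ex m Vx + ex m Vy + ex m Vz + ex m Vu" for m
    unfolding embedded_exps_def emb_def g P2 P_def[symmetric] by auto
  have 1: "vprime {Vx, Vy} \<in> Ass (mspan (embedded_exps e k) :: 'k poly4 set)"
    by (rule vprime_in_Ass[where p = "mon (P - 1) 0 0 (k + 1)"])
       (use k in \<open>auto simp: mem lookup_add\<close>)
  have 2: "vprime UNIV \<in> Ass (mspan (embedded_exps e k) :: 'k poly4 set)"
    by (rule vprime_in_Ass[where p = "mon P 0 0 (k - 1)"])
       (use k in \<open>auto simp: mem lookup_add UNIV_var\<close>)
  show "vprime ` ?F \<subseteq> Ass (mspan (embedded_exps e k) :: 'k poly4 set)"
    using 1 2 by blast
qed

text \<open>For \<open>e = k + 2\<close> the first gap is the single exponent \<open>k + 1\<close>.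
  From there \<open>x\<close> and \<open>y\<close> lead to its borders and \<open>z\<close> lifts
  the gap condition, but no power of \<open>u\<close> helps. The factor u^k provides the total
  degree.\<close>

lemma Ass_embedded_gap:
  assumes k: "1 \<le> k"
  shows "vprime {Vx, Vy, Vz} \<in> Ass (mspan (embedded_exps (k + 2) k) :: 'k::field poly4 set)"
proof (rule vprime_in_Ass)
  define P where "P = (k + 2 + 1) * k"
  have P: "k + 3 \<le> P" "(k + 2 + 2) * k = P + k" using k by (cases k; simp add: P_def)+
  have g: "gapped (k + 2) k (x + (k + 1)) (y + (P - (k + 1))) \<longleftrightarrow> x \<noteq> 0 \<or> y \<noteq> 0" for x y
  proof
    show "x \<noteq> 0 \<or> y \<noteq> 0" if "gapped (k + 2) k (x + (k + 1)) (y + (P - (k + 1)))"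
      using not_gapped[of "x + (k + 1)" "k + 2" "y + (P - (k + 1))" k] that P(1)
      unfolding P_def[symmetric] by linarith
    show "gapped (k + 2) k (x + (k + 1)) (y + (P - (k + 1)))" if "x \<noteq> 0 \<or> y \<noteq> 0"
      using gapped_i0[OF k, of "k + 2" "x + (k + 1)" "y + (P - (k + 1))"] that P(1)
        gapped_i1[of k k "x + (k + 1)" "k + 2" "y + (P - (k + 1))"]
      unfolding P_def[symmetric] by linarith
  qed
  have a: "P \<le> x + (k + 1) + (y + (P - (k + 1)))" "P + k \<le> x + (k + 1) + (y + (P - (k + 1))) + z + (u + k)"
    for x y z u using P(1) by linarith+
  show "m + mon (k + 1) (P - (k + 1)) 0 k \<in> embedded_exps (k + 2) k \<longleftrightarrow> (\<exists>v\<in>{Vx, Vy, Vz}. ex m v \<noteq> 0)" for m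
    unfolding embedded_exps_def emb_def mem_Collect_eq lookup_add ex_mon P_def[symmetric] P(2) g
    using a(1)[of "ex m Vx" "ex m Vy"] a(2)[of "ex m Vx" "ex m Vy" "ex m Vz" "ex m Vu"] by auto
qed

section \<open>Depths of the powers\<close>

lemma koszul0_mspan:
  assumes "p \<notin> U" "\<And>v. Poly_Mapping.single v 1 + p \<in> U"
  shows "koszul0 X (mspan U :: 'k::field poly4 set)"
  unfolding koszul0_def using assms by (intro exI[of _ "monom p"]) (simp add: mult_single)

text \<open>The class vanishes outside the variables in \<open>W\<close> and equals \<open>p\<close> on them: a section that
  is not constant because the degree complex of \<open>U\<close> at \<open>p\<close> is disconnected.\<close>

lemma koszul1_mspan:
  assumes U: "upset U" and W: "\<And>v w. v \<in> W \<Longrightarrow> w \<notin> W \<Longrightarrow> Poly_Mapping.single v 1 + (Poly_Mapping.single w 1 + p) \<in> U"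
    and v: "v \<in> W" "Poly_Mapping.single v 1 + p \<notin> U" and w: "w \<notin> W" "Poly_Mapping.single w 1 + p \<notin> U"
  shows "koszul1 X (mspan U :: 'k::field poly4 set)"
  unfolding koszul1_def
proof (intro exI conjI allI notI)
  let ?a = "\<lambda>i. if i \<in> W then X i * monom p else 0 :: 'k poly4"
  note I = is_idealD[OF is_ideal_mspan[OF U, where ?'k = 'k]]
  show "X i * ?a j - X j * ?a i \<in> mspan U" for i j
  proof -
    have "X j * (X i * monom p) \<in> (mspan U :: 'k poly4 set)" if "i \<in> W" "j \<notin> W"
      using W[OF that] by (simp add: mult_single add.left_commute)
    moreover have "X i * (X j * monom p) \<in> (mspan U :: 'k poly4 set)" if "j \<in> W" "i \<notin> W"
      using W[OF that] by (simp add: mult_single add.left_commute)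
    moreover have "X i * (X j * monom p) - X j * (X i * monom p) = (0 :: 'k poly4)"
      by (simp add: mult_ac)
    ultimately show ?thesis using I(1) I(5) by (auto simp del: mspan_single)
  qed
  assume "\<exists>c. \<forall>i. ?a i - X i * c \<in> mspan U"
  then obtain c where c: "\<And>i. ?a i - X i * c \<in> mspan U" by blast
  have "Poly_Mapping.lookup c p = 1" using mspan_lookup[OF c[of v] v(2)] v(1)
    by (simp add: lookup_minus lookup_single_mult)
  moreover have "Poly_Mapping.lookup c p = 0" using mspan_lookup[OF c[of w] w(2)] w(1)
    by (simp add: lookup_minus lookup_single_mult)
  ultimately show False by simp
qed

text \<open>The monomial x^P u^(k-1) fails only by one in total degree, gaps or not, so it is a
  socle element.\<close>

lemma depth_embedded:
  assumes k: "1 \<le> k"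
  shows "depth_quot (mspan (embedded_exps e k) :: 'k::field poly4 set) = 0"
proof -
  let ?J = "mspan (embedded_exps e k) :: 'k poly4 set"
  define P where "P = (e + 1) * k"
  have P: "1 \<le> P" "(e + 2) * k = P + k" using k by (auto simp: P_def)
  note J = is_ideal_mspan[OF upset_embedded_exps[of e k], where ?'k = 'k]
  have "koszul0 X ?J"
  proof (rule koszul0_mspan)
    show "mon P 0 0 (k - 1) \<notin> embedded_exps e k"
    proof
      assume "mon P 0 0 (k - 1) \<in> embedded_exps e k"
      then have "P + k \<le> P + 0 + 0 + (k - 1)"
        unfolding embedded_exps_def emb_def mem_Collect_eq ex_mon P(2) by blast
      then show False using k by linarith
    qed
    show "Poly_Mapping.single v 1 + mon P 0 0 (k - 1) \<in> embedded_exps e k" for v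
      using k gapped_top[of e k, folded P_def]
      unfolding embedded_exps_def emb_def mem_Collect_eq lookup_add ex_mon P(2) P_def[symmetric]
      by (cases v) auto
  qed
  then have "koszul0 X (ideal_gen (?J \<union> set (take 0 fs)))" for fs by (simp add: ideal_gen_ideal[OF J])
  then have "depth_quot ?J \<le> 0" using regular_seq_koszul0[OF _ J, of _ 0] by (intro depth_quot_le) blast
  then show ?thesis by simp
qed

text \<open>At \<open>p\<close> the degree complex consists of the disjoint edges xy and zu. The
  sums over xy and zu equal those over xu and yz together, so falling one short on zu forces degree
  \<open>P + 1\<close> on xy. Hence the gap must contain two exponents, \<open>k + 1\<close> and
  \<open>k + 2\<close>, and \<open>e = k + 3\<close>.\<close>

lemma depth_cycle_gap:
  assumes k: "1 \<le> k"
  shows "depth_quot (mspan (cycle_exps (k + 3) k) :: 'k::field poly4 set) \<le> 1"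
proof -
  let ?J = "mspan (cycle_exps (k + 3) k) :: 'k poly4 set"
  define P where "P = (k + 3 + 1) * k"
  have P: "k + 4 \<le> P" using k by (cases k) (simp_all add: P_def)
  note J = is_ideal_mspan[OF upset_cycle_exps[of "k + 3" k], where ?'k = 'k]
  define p where "p = mon (k + 2) (P - (k + 1)) (k + 1) (P - (k + 2))"
  have g: "gapped (k + 3) k (x + (k + 2)) (y + (P - (k + 1))) \<longleftrightarrow> x \<noteq> 0 \<or> y \<noteq> 0" for x y
  proof
    show "x \<noteq> 0 \<or> y \<noteq> 0" if "gapped (k + 3) k (x + (k + 2)) (y + (P - (k + 1)))"
      using not_gapped[of "x + (k + 2)" "k + 3" "y + (P - (k + 1))" k] that P
      unfolding P_def[symmetric] by linarith
    show "gapped (k + 3) k (x + (k + 2)) (y + (P - (k + 1)))" if "x \<noteq> 0 \<or> y \<noteq> 0"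
      using gapped_i0[OF k, of "k + 3" "x + (k + 2)" "y + (P - (k + 1))"] that P
        gapped_i1[of k k "x + (k + 2)" "k + 3" "y + (P - (k + 1))"]
      unfolding P_def[symmetric] by linarith
  qed
  have p: "m + p \<in> cycle_exps (k + 3) k \<longleftrightarrow>
      (ex m Vx \<noteq> 0 \<or> ex m Vy \<noteq> 0) \<and> (ex m Vz \<noteq> 0 \<or> ex m Vu \<noteq> 0)" for m
  proof -
    have "P \<le> x + (k + 2) + (u + (P - (k + 2)))" "P \<le> y + (P - (k + 1)) + (z + (k + 1))"
      "P \<le> z + (k + 1) + (u + (P - (k + 2))) \<longleftrightarrow> z \<noteq> 0 \<or> u \<noteq> 0" for x y z u
      using P by linarith+
    then show ?thesis
      unfolding cycle_exps_def cyc_def p_def mem_Collect_eq lookup_add ex_mon g P_def[symmetric] by blast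
  qed
  have "koszul1 X ?J"
  proof (rule koszul1_mspan[OF upset_cycle_exps, where W = "{Vx, Vy}" and v = Vx and w = Vz])
    fix v w assume "v \<in> {Vx, Vy}" "w \<notin> {Vx, Vy}"
    then show "Poly_Mapping.single v 1 + (Poly_Mapping.single w 1 + p) \<in> cycle_exps (k + 3) k"
      unfolding add.assoc[symmetric] p by (cases w) (auto simp: lookup_add)
  qed (simp_all add: p)
  then have "koszul1 X (ideal_gen (?J \<union> set (take 0 fs)))" for fs by (simp add: ideal_gen_ideal[OF J])
  then show ?thesis using regular_seq_koszul1[OF _ J, of _ 0] by (intro depth_quot_le) auto
qed

section \<open>The depth of the powers of \<open>(xz, yu)\<close>\<close>

lemma nonzerodivisor_mspan:
  fixes g :: "'k::field poly4"
  assumes "S = (\<Inter>V\<in>F. U V)" "\<And>V. V \<in> F \<Longrightarrow> upset (U V) \<and> depends_on V (U V) \<and> g \<notin> vprime V"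
  shows "nonzerodivisor_mod (mspan S) g"
  unfolding nonzerodivisor_mod_def
proof (intro allI impI)
  fix f assume "f * g \<in> mspan S"
  then have "g * f \<in> mspan (U V)" if "V \<in> F" for V
    using that unfolding assms(1) mspan_def by (auto simp: mult.commute)
  then have "f \<in> mspan (U V)" if "V \<in> F" for V
    using that assms(2)[OF that] mspan_primary by blast
  then show "f \<in> mspan S" unfolding assms(1) mspan_def by auto
qed

lemma diff_not_vprime:
  assumes "v \<noteq> w" "\<not> {v, w} \<subseteq> V" shows "X v - X w \<notin> (vprime V :: 'k::field poly4 set)"
proof
  assume h: "X v - X w \<in> (vprime V :: 'k poly4 set)"
  have "Poly_Mapping.single v (1::nat) \<noteq> Poly_Mapping.single w 1"
    using assms(1) by (metis ex_single zero_neq_one)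
  then have "{Poly_Mapping.single v 1, Poly_Mapping.single w 1} \<subseteq> Poly_Mapping.keys (X v - X w :: 'k poly4)"
    by (auto simp: in_keys_iff lookup_minus lookup_single when_def)
  then have "\<exists>i\<in>V. ex (Poly_Mapping.single v 1) i \<noteq> 0" "\<exists>i\<in>V. ex (Poly_Mapping.single w 1) i \<noteq> 0"
    using h unfolding vprime_def mspan_def by blast+
  then show False using assms(2) by (auto split: if_splits)
qed

lemma single_var_neq_0: "Poly_Mapping.single v (Suc 0) \<noteq> 0" for v :: var
proof
  assume "Poly_Mapping.single v (Suc 0) = 0"
  from arg_cong[OF this, of "\<lambda>m. ex m v"] show False by simp
qed

lemma diff_in_graded_max: "X v - X w \<in> graded_max"
  by (simp add: graded_max_def lookup_minus lookup_single when_def single_var_neq_0)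

lemma is_ideal_graded_max: "is_ideal graded_max"
  unfolding graded_max_eq vprime_def by (rule is_ideal_mspan[OF upset_vprime])

lemma regular_seq_two:
  fixes J :: "'k::field poly4 set"
  assumes J: "is_ideal J" "J \<subseteq> graded_max" and fg: "f \<in> graded_max" "g \<in> graded_max"
    and reg: "nonzerodivisor_mod J f" "nonzerodivisor_mod (ideal_gen (insert f J)) g"
  shows "regular_seq J [f, g]"
  unfolding regular_seq_def
proof (intro conjI allI impI)
  show "set [f, g] \<subseteq> graded_max" using fg by simp
  fix i h assume "i < length [f, g]"
  then consider "i = 0" | "i = 1" by fastforce
  then show "h \<in> ideal_sum J (ideal_gen (set (take i [f, g])))"
    if "h * [f, g] ! i \<in> ideal_sum J (ideal_gen (set (take i [f, g])))"
    using that reg by cases (auto simp: ideal_sum_gen[OF J(1)] ideal_gen_ideal[OF J(1)] nonzerodivisor_mod_def)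
next
  have "ideal_gen (J \<union> set [f, g]) \<subseteq> graded_max"
    using J fg by (intro ideal_gen_least[OF is_ideal_graded_max]) auto
  moreover have "1 \<notin> (graded_max :: 'k poly4 set)" by (simp add: graded_max_def)
  ultimately show "ideal_sum J (ideal_gen (set [f, g])) \<noteq> UNIV" unfolding ideal_sum_gen[OF J(1)] by blast
qed

text \<open>The exponents of (xz, yu)^N: the minima are the largest powers of xz and yu dividing the
  monomial.\<close>

definition ci_exps :: "nat \<Rightarrow> (var \<Rightarrow>\<^sub>0 nat) set" where
  "ci_exps N = {m. N \<le> min (ex m Vx) (ex m Vz) + min (ex m Vy) (ex m Vu)}"

lemma upset_ci_exps: "upset (ci_exps N)"
  unfolding upset_def ci_exps_def mem_Collect_eq lookup_add
  by (intro ballI allI, drule CollectD, erule order_trans, intro add_mono min.mono le_add1)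

text \<open>With the gaps closed only the four edge sums matter, and their minimum is the sum of the
  two minima.\<close>

lemma cycle_exps_stable:
  assumes "1 < e" "e - 1 \<le> k" shows "cycle_exps e k = ci_exps ((e + 1) * k)"
proof -
  have "N \<le> a + b \<and> N \<le> c + d \<and> N \<le> a + d \<and> N \<le> b + c \<longleftrightarrow> N \<le> min a c + min b d" for N a b c d :: nat
    by linarith
  then show ?thesis unfolding cycle_exps_def cyc_def gapped_stable[OF assms] ci_exps_def by simp
qed

text \<open>At \<open>p = x^(N-1) z^(N-1)\<close> the degree complex is the 4-cycle x, y, z, u, and
  \<open>M\<close> is the monomial zu times \<open>p\<close>. A trivialization would give
  differences of \<open>l\<close> along the cycle that vanish on three edges and equal 1 on
  zu.\<close>

lemma koszul2_ci:
  assumes N: "1 \<le> N"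
  shows "koszul2 X (mspan (ci_exps N) :: 'k::field poly4 set)"
  unfolding koszul2_def
proof (intro exI conjI allI notI)
  define M :: "'k poly4" where "M = monom (mon (N - 1) 0 N 1)"
  let ?a = "\<lambda>i j. if i = Vz \<and> j = Vu then M else if i = Vu \<and> j = Vz then - M else 0"
  note I = is_idealD[OF is_ideal_mspan[OF upset_ci_exps[of N], where ?'k = 'k]]
  have M: "X Vx * M \<in> mspan (ci_exps N)" "X Vy * M \<in> mspan (ci_exps N)"
    using N by (simp_all add: M_def mult_single ci_exps_def lookup_add)
  show "X i * ?a j k - X j * ?a i k + X k * ?a i j \<in> mspan (ci_exps N)" for i j k
    using M I(1) I(5)[OF M(1)] I(5)[OF M(2)] by (cases i; cases j; cases k; simp)
  assume "\<exists>c. \<forall>i j. ?a i j - (X i * c j - X j * c i) \<in> mspan (ci_exps N)"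
  then obtain c where c: "\<And>i j. ?a i j - (X i * c j - X j * c i) \<in> mspan (ci_exps N)" by blast
  define p where "p = mon (N - 1) 0 (N - 1) 0"
  define l where "l i = Poly_Mapping.lookup (c i) (Poly_Mapping.single i 1 + p)" for i
  have eq: "l j - l i = Poly_Mapping.lookup (?a i j) (Poly_Mapping.single i 1 + (Poly_Mapping.single j 1 + p))"
    if "Poly_Mapping.single i 1 + (Poly_Mapping.single j 1 + p) \<notin> ci_exps N" for i j
  proof -
    have "Poly_Mapping.lookup (X i * c j) (Poly_Mapping.single i 1 + (Poly_Mapping.single j 1 + p)) = l j"
      by (simp only: lookup_single_mult l_def mult_1_left)
    moreover have "Poly_Mapping.lookup (X j * c i) (Poly_Mapping.single i 1 + (Poly_Mapping.single j 1 + p)) = l i"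
      unfolding add.left_commute[of "Poly_Mapping.single i 1"] by (simp only: lookup_single_mult l_def mult_1_left)
    ultimately show ?thesis using mspan_lookup[OF c[of i j] that] unfolding lookup_minus by simp
  qed
  have "l Vy - l Vx = 0" using N eq[of Vx Vy] by (simp add: ci_exps_def lookup_add p_def)
  moreover have "l Vu - l Vx = 0" using N eq[of Vx Vu] by (simp add: ci_exps_def lookup_add p_def)
  moreover have "l Vz - l Vy = 0" using N eq[of Vy Vz] by (simp add: ci_exps_def lookup_add p_def)
  moreover have "l Vu - l Vz = 1"
  proof -
    have "Poly_Mapping.single Vz 1 + (Poly_Mapping.single Vu 1 + p) = mon (N - 1) 0 N 1"
      using N by (intro monom_eqI) (simp_all add: p_def lookup_add)
    then show ?thesis using N eq[of Vz Vu] by (simp add: ci_exps_def M_def)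
  qed
  ultimately show False by simp
qed

text \<open>The substitution \<open>z \<mapsto> x\<close> computes modulo \<open>x - z\<close> inside the same ring.\<close>

definition fold_exp :: "(var \<Rightarrow>\<^sub>0 nat) \<Rightarrow> (var \<Rightarrow>\<^sub>0 nat)" where
  "fold_exp m = mon (ex m Vx + ex m Vz) (ex m Vy) 0 (ex m Vu)"

definition fold_poly :: "'k::field poly4 \<Rightarrow> 'k poly4" where
  "fold_poly f = (\<Sum>m\<in>Poly_Mapping.keys f. Poly_Mapping.single (fold_exp m) (Poly_Mapping.lookup f m))"

lemma fold_exp_add: "fold_exp (m + n) = fold_exp m + fold_exp n"
  by (rule monom_eqI) (simp_all add: fold_exp_def lookup_add)

lemma fold_poly_superset:
  assumes "finite A" "Poly_Mapping.keys f \<subseteq> A"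
  shows "fold_poly f = (\<Sum>m\<in>A. Poly_Mapping.single (fold_exp m) (Poly_Mapping.lookup f m))"
  unfolding fold_poly_def using assms by (intro sum.mono_neutral_left) (auto simp: in_keys_iff)

lemma fold_poly_add: "fold_poly (f + g) = fold_poly f + fold_poly g"
proof -
  let ?A = "Poly_Mapping.keys f \<union> Poly_Mapping.keys g"
  have "fold_poly h = (\<Sum>m\<in>?A. Poly_Mapping.single (fold_exp m) (Poly_Mapping.lookup h m))"
    if "Poly_Mapping.keys h \<subseteq> ?A" for h using that by (intro fold_poly_superset) auto
  note this[of f, OF Un_upper1] this[of g, OF Un_upper2] this[of "f + g", OF keys_add]
  then show ?thesis by (simp only: lookup_add single_add sum.distrib)
qed

lemma fold_poly_single: "fold_poly (Poly_Mapping.single m c) = Poly_Mapping.single (fold_exp m) c"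
  by (simp add: fold_poly_def)

lemma fold_poly_sum: "fold_poly (sum f A) = (\<Sum>a\<in>A. fold_poly (f a))"
  by (induction A rule: infinite_finite_induct) (auto simp: fold_poly_add, auto simp: fold_poly_def)

lemma fold_poly_diff: "fold_poly (f - g) = fold_poly f - fold_poly g"
  using fold_poly_add[of "f - g" g] by simp

lemma fold_poly_mult: "fold_poly (f * g) = fold_poly f * fold_poly g"
proof -
  let ?t = "\<lambda>f :: 'a poly4. \<lambda>m. Poly_Mapping.single m (Poly_Mapping.lookup f m)"
  have "fold_poly (f * g) = fold_poly ((\<Sum>m\<in>Poly_Mapping.keys f. ?t f m) * (\<Sum>n\<in>Poly_Mapping.keys g. ?t g n))"
    using poly_mapping_sum_single[of f] poly_mapping_sum_single[of g] by simp
  also have "\<dots> = fold_poly f * fold_poly g"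
    unfolding sum_product fold_poly_sum mult_single fold_poly_single fold_exp_add
    by (simp add: fold_poly_def sum_product mult_single)
  finally show ?thesis .
qed

lemma mon_ex: "m = mon (ex m Vx) (ex m Vy) (ex m Vz) (ex m Vu)"
  by (rule monom_eqI) simp_all

text \<open>A telescoping sum exchanging one \<open>x\<close> for one \<open>z\<close> at a time;
  \<open>r\<close> varies because each exchange raises the exponent of \<open>z\<close>.\<close>

lemma shift_exp:
  fixes I :: "'k::field poly4 set"
  assumes I: "is_ideal I" "X Vx - X Vz \<in> I"
  shows "Poly_Mapping.single (mon (a + n) b r d) c - Poly_Mapping.single (mon a b (n + r) d) c \<in> I"
proof (induction n arbitrary: r)
  case 0 then show ?case using is_idealD(1)[OF I(1)] by simp
next
  case (Suc n)
  let ?s = "\<lambda>m. Poly_Mapping.single m c :: 'k poly4"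
  have "mon (a + n) b r d + Poly_Mapping.single Vx 1 = mon (a + Suc n) b r d"
    "mon (a + n) b r d + Poly_Mapping.single Vz 1 = mon (a + n) b (Suc r) d"
    by (rule monom_eqI; simp add: lookup_add)+
  then have "?s (mon (a + n) b r d) * (X Vx - X Vz) = ?s (mon (a + Suc n) b r d) - ?s (mon (a + n) b (Suc r) d)"
    by (simp only: right_diff_distrib mult_single mult_1_right)
  then have "?s (mon (a + Suc n) b r d) - ?s (mon (a + n) b (Suc r) d) \<in> I"
    using is_idealD(3)[OF I] by metis
  from is_idealD(2)[OF I(1) this Suc.IH[of "Suc r"]] show ?case by simp
qed

lemma diff_fold_poly:
  fixes I :: "'k::field poly4 set"
  assumes I: "is_ideal I" "X Vx - X Vz \<in> I"
  shows "fold_poly f - f \<in> I"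
proof -
  have s: "Poly_Mapping.single (fold_exp m) c - Poly_Mapping.single m c \<in> I" for m c
    using shift_exp[OF I, of "ex m Vx" "ex m Vz" "ex m Vy" 0 "ex m Vu" c] mon_ex[of m]
    by (simp add: fold_exp_def)
  have "(\<Sum>m\<in>Poly_Mapping.keys f. Poly_Mapping.single (fold_exp m) (Poly_Mapping.lookup f m)
      - Poly_Mapping.single m (Poly_Mapping.lookup f m)) \<in> I"
    by (rule ideal_sum_mem[OF I(1) s])
  then show ?thesis
    by (simp add: sum_subtractf fold_poly_def flip: poly_mapping_sum_single)
qed

text \<open>The exponents of (x^2, yu)^N, generated by the image of (xz, yu)^N under the
  substitution.\<close>

definition folded_exps :: "nat \<Rightarrow> (var \<Rightarrow>\<^sub>0 nat) set" where
  "folded_exps N = {m. N \<le> ex m Vx div 2 + min (ex m Vy) (ex m Vu)}"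

text \<open>The substitution carries the problem to (x^2, yu)^N, where y - u can be cancelled. The
  result comes back because this ideal lies in \<open>?I\<close> and \<open>h\<close> is congruent
  to \<open>fold_poly h\<close>.\<close>

lemma ci_second_nonzerodivisor:
  "nonzerodivisor_mod (ideal_gen (insert (X Vx - X Vz) (mspan (ci_exps N)))) (X Vy - X Vu :: 'k::field poly4)"
  unfolding nonzerodivisor_mod_def
proof (intro allI impI)
  let ?C = "mspan (ci_exps N) :: 'k poly4 set"
  let ?I = "ideal_gen (insert (X Vx - X Vz) ?C)"
  note C = is_ideal_mspan[OF upset_ci_exps[of N], where ?'k = 'k]
  have xz: "X Vx - X Vz \<in> ?I" and CI: "?C \<subseteq> ?I" using ideal_gen_superset[of "insert (X Vx - X Vz) ?C"] by auto
  note I = is_ideal_gen[of "insert (X Vx - X Vz) ?C"]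
  have fold_C: "fold_poly f \<in> mspan (folded_exps N)" if "f \<in> ?C" for f
  proof -
    have "upset (folded_exps N)"
      unfolding upset_def folded_exps_def mem_Collect_eq lookup_add
      by (intro ballI allI, drule CollectD, erule order_trans, intro add_mono min.mono div_le_mono le_add1)
    moreover have "fold_exp m \<in> folded_exps N" if "m \<in> ci_exps N" for m
    proof -
      have "min a b \<le> (a + b) div 2" for a b :: nat by linarith
      from order_trans[OF _ add_right_mono[OF this]] that show ?thesis
        unfolding ci_exps_def folded_exps_def fold_exp_def mem_Collect_eq ex_mon by blast
    qed
    ultimately show ?thesis
      unfolding fold_poly_def using that
      by (intro ideal_sum_mem[OF is_ideal_mspan]) (auto simp: mspan_def)
  qed
  \<comment> \<open>Modulo x - z, half of the exponent of \<open>x\<close>, rounded down, is moved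
    to \<open>z\<close>.\<close>
  have CI': "mspan (folded_exps N) \<subseteq> ?I"
  proof
    fix f :: "'k poly4" assume f: "f \<in> mspan (folded_exps N)"
    have "Poly_Mapping.single m c \<in> ?I" if m: "m \<in> folded_exps N" for m c
    proof -
      let ?a = "ex m Vx - ex m Vx div 2" and ?n = "ex m Vx div 2"
      have "mon ?a (ex m Vy) (?n + ex m Vz) (ex m Vu) \<in> ci_exps N"
      proof -
        have "a div 2 \<le> min (a - a div 2) (a div 2 + b)" for a b :: nat by linarith
        from order_trans[OF _ add_right_mono[OF this]] m show ?thesis
          unfolding ci_exps_def folded_exps_def mem_Collect_eq ex_mon by blast
      qed
      then have "Poly_Mapping.single (mon ?a (ex m Vy) (?n + ex m Vz) (ex m Vu)) c \<in> ?I"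
        using CI by auto
      from is_idealD(2)[OF I shift_exp[OF I xz, of ?a ?n "ex m Vy" "ex m Vz" "ex m Vu" c] this]
      show ?thesis using mon_ex[of m] by simp
    qed
    then have "(\<Sum>m\<in>Poly_Mapping.keys f. Poly_Mapping.single m (Poly_Mapping.lookup f m)) \<in> ?I"
      using f by (intro ideal_sum_mem[OF I]) (auto simp: mspan_def)
    then show "f \<in> ?I" by (simp flip: poly_mapping_sum_single)
  qed
  \<comment> \<open>The minimum of the exponents of \<open>y\<close> and \<open>u\<close> splits the
    ideal into two components, whose primes (x, y) and (x, u) both miss y - u.\<close>
  have reg: "nonzerodivisor_mod (mspan (folded_exps N)) (X Vy - X Vu :: 'k poly4)"
  proof (rule nonzerodivisor_mspan[where F = "{{Vx, Vy}, {Vx, Vu}}" and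
        U = "\<lambda>V. {m. N \<le> ex m Vx div 2 + (\<Sum>v\<in>V - {Vx}. ex m v)}"])
    show "folded_exps N = (\<Inter>V\<in>{{Vx, Vy}, {Vx, Vu}}. {m. N \<le> ex m Vx div 2 + (\<Sum>v\<in>V - {Vx}. ex m v)})"
      by (auto simp: folded_exps_def)
    fix V assume V: "V \<in> {{Vx, Vy}, {Vx, Vu}}"
    have "upset {m. N \<le> ex m Vx div 2 + (\<Sum>v\<in>V - {Vx}. ex m v)}"
      unfolding upset_def mem_Collect_eq lookup_add sum.distrib
      by (intro ballI allI, drule CollectD, erule order_trans, intro add_mono div_le_mono le_add1)
    moreover have "depends_on V {m. N \<le> ex m Vx div 2 + (\<Sum>v\<in>V - {Vx}. ex m v)}"
      using V by (auto simp: depends_on_def)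
    moreover have "X Vy - X Vu \<notin> (vprime V :: 'k poly4 set)" by (rule diff_not_vprime) (use V in auto)
    ultimately show "upset {m. N \<le> ex m Vx div 2 + (\<Sum>v\<in>V - {Vx}. ex m v)} \<and>
      depends_on V {m. N \<le> ex m Vx div 2 + (\<Sum>v\<in>V - {Vx}. ex m v)} \<and> X Vy - X Vu \<notin> (vprime V :: 'k poly4 set)"
      by blast
  qed
  have fx: "fold_exp (Poly_Mapping.single Vx 1) = Poly_Mapping.single Vx 1"
    "fold_exp (Poly_Mapping.single Vz 1) = Poly_Mapping.single Vx 1"
    "fold_exp (Poly_Mapping.single Vy 1) = Poly_Mapping.single Vy 1"
    "fold_exp (Poly_Mapping.single Vu 1) = Poly_Mapping.single Vu 1"
    by (rule monom_eqI; simp add: fold_exp_def)+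
  fix h assume "h * (X Vy - X Vu) \<in> ?I"
  then obtain a r where ar: "h * (X Vy - X Vu) = a + r * (X Vx - X Vz)" "a \<in> ?C"
    unfolding ideal_gen_insert ideal_gen_ideal[OF C] by blast
  have "fold_poly h * (X Vy - X Vu) = fold_poly (h * (X Vy - X Vu))"
    by (simp only: fold_poly_mult fold_poly_diff fold_poly_single fx)
  also have "\<dots> = fold_poly a"
    unfolding ar(1) by (simp only: fold_poly_add fold_poly_mult fold_poly_diff fold_poly_single fx) simp
  finally have "fold_poly h * (X Vy - X Vu) \<in> mspan (folded_exps N)" using fold_C[OF ar(2)] by simp
  then have "fold_poly h \<in> ?I" using reg CI' unfolding nonzerodivisor_mod_def by blast
  from is_idealD(6)[OF I this diff_fold_poly[OF I xz, of h]] show "h \<in> ?I" by simp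
qed

lemma depth_ci:
  assumes N: "1 \<le> N"
  shows "depth_quot (mspan (ci_exps N) :: 'k::field poly4 set) = 2"
proof (rule antisym)
  let ?C = "mspan (ci_exps N) :: 'k poly4 set"
  let ?F = "{{Vx, Vy}, {Vz, Vu}, {Vx, Vu}, {Vy, Vz}}"
  note C = is_ideal_mspan[OF upset_ci_exps[of N], where ?'k = 'k]
  have "koszul2 X (ideal_gen (?C \<union> set (take 0 fs)))" for fs
    using koszul2_ci[OF N] by (simp add: ideal_gen_ideal[OF C])
  then have le: "length fs \<le> 2" if "regular_seq ?C fs" for fs
    using regular_seq_koszul2[OF that C, of 0] by auto
  then show "depth_quot ?C \<le> 2" by (rule depth_quot_le)
  have "0 \<notin> ci_exps N" using N by (simp add: ci_exps_def)
  then have CM: "?C \<subseteq> graded_max" by (auto simp: graded_max_def mspan_def in_keys_iff)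
  \<comment> \<open>The pair x, z is no edge of the 4-cycle, so x - z avoids all four
    primes.\<close>
  have "nonzerodivisor_mod ?C (X Vx - X Vz)"
  proof (rule nonzerodivisor_mspan[where F = ?F and U = "\<lambda>V. {m. N \<le> (\<Sum>v\<in>V. ex m v)}"])
    show "ci_exps N = (\<Inter>V\<in>?F. {m. N \<le> (\<Sum>v\<in>V. ex m v)})"
      by (auto simp: ci_exps_def)
    fix V assume V: "V \<in> ?F"
    have "X Vx - X Vz \<notin> (vprime V :: 'k poly4 set)" by (rule diff_not_vprime) (use V in auto)
    then show "upset {m. N \<le> (\<Sum>v\<in>V. ex m v)} \<and> depends_on V {m. N \<le> (\<Sum>v\<in>V. ex m v)} \<and>
        X Vx - X Vz \<notin> (vprime V :: 'k poly4 set)"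
      using V by (auto simp: upset_def depends_on_def lookup_add)
  qed
  then have "regular_seq ?C [X Vx - X Vz, X Vy - X Vu]"
    by (intro regular_seq_two C CM diff_in_graded_max ci_second_nonzerodivisor)
  from depth_quot_ge[OF le this] show "2 \<le> depth_quot ?C" by simp
qed

section \<open>Comparison of the stability indices\<close>

lemma Least_stable_eq_1:
  fixes f :: "nat \<Rightarrow> 'b"
  assumes "\<And>k. 1 \<le> k \<Longrightarrow> f k = f 1"
  shows "(LEAST k0. 0 < k0 \<and> (\<forall>k\<ge>k0. f k = f k0)) = 1"
proof (rule Least_equality)
  show "0 < (1::nat) \<and> (\<forall>k\<ge>1. f k = f 1)" using assms by blast
qed linarith

text \<open>\<open>n\<close> shows that a stable index exists, so \<open>LEAST\<close> is attained.
  From the least one on the value is \<open>b\<close>, hence \<open>K\<close> lies below it.\<close>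

lemma Least_stable_gt:
  fixes f :: "nat \<Rightarrow> 'b"
  assumes "0 < n" "\<And>k. n \<le> k \<Longrightarrow> f k = b" "f K \<noteq> b"
  shows "K < (LEAST k0. 0 < k0 \<and> (\<forall>k\<ge>k0. f k = f k0))"
proof -
  let ?P = "\<lambda>k0. 0 < k0 \<and> (\<forall>k\<ge>k0. f k = f k0)"
  let ?L = "LEAST k0. ?P k0"
  have "?P n" using assms(1,2) by simp
  then have L: "?P ?L" by (rule LeastI)
  show ?thesis
  proof (rule ccontr)
    assume "\<not> K < ?L"
    then have "?L \<le> K" by (rule leI)
    then have "f K = f ?L" by (rule L[THEN conjunct2, rule_format])
    moreover have "f (max n ?L) = f ?L" by (rule L[THEN conjunct2, rule_format]) simp
    moreover have "f (max n ?L) = b" using assms(2) by simp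
    ultimately show False using assms(3) by simp
  qed
qed

theorem theorem2p3:
  fixes c :: nat
  shows "\<exists>(I::'k::field poly4 set) (J::'k poly4 set).
           monomial_ideal I \<and> monomial_ideal J \<and>
           int (astab I) - int (dstab I) \<ge> int c \<and>
           int (dstab J) - int (astab J) \<ge> int c"
proof -
  \<comment> \<open>The successor ensures that \<open>K\<close> is positive. The offsets 2 and 3 in
    \<open>e\<close> leave gaps of one and two exponents in the \<open>K\<close>-th powers;
    stability holds from \<open>e - 1\<close> on.\<close>
  define K where "K = c + 1"
  have K: "1 \<le> K" by (simp add: K_def)
  define I J :: "'k poly4 set" where "I = mspan (embedded_exps (K + 2) 1)" and "J = mspan (cycle_exps (K + 3) 1)"
  have pI: "ideal_pow I k = mspan (embedded_exps (K + 2) k)" for k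
    unfolding I_def by (rule ideal_pow_embedded)
  have pJ: "ideal_pow J k = mspan (cycle_exps (K + 3) k)" for k
    unfolding J_def by (rule ideal_pow_cycle)
  have "dstab I = 1"
    unfolding dstab_def by (rule Least_stable_eq_1) (simp only: pI depth_embedded order_refl)
  moreover have "K < astab I"
    unfolding astab_def
  proof (rule Least_stable_gt[where n = "K + 1"])
    show "Ass (ideal_pow I k) = vprime ` {{Vx, Vy}, UNIV}" if "K + 1 \<le> k" for k
      unfolding pI by (rule Ass_embedded_stable) (use that in auto)
    have "{Vx, Vy, Vz} \<notin> {{Vx, Vy}, UNIV}" by (auto simp: UNIV_var)
    then have "vprime {Vx, Vy, Vz} \<notin> (vprime ` {{Vx, Vy}, UNIV} :: 'k poly4 set set)"
      by (simp only: inj_image_mem_iff[OF inj_vprime] not_False_eq_True)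
    then show "Ass (ideal_pow I K) \<noteq> vprime ` {{Vx, Vy}, UNIV}"
      using Ass_embedded_gap[OF K, where ?'k = 'k] unfolding pI by metis
  qed simp
  moreover have "astab J = 1"
    unfolding astab_def by (rule Least_stable_eq_1) (simp only: pJ Ass_cycle order_refl)
  moreover have "K < dstab J"
    unfolding dstab_def
  proof (rule Least_stable_gt[where n = "K + 2"])
    show "depth_quot (ideal_pow J k) = 2" if "K + 2 \<le> k" for k
    proof -
      have "cycle_exps (K + 3) k = ci_exps ((K + 3 + 1) * k)" by (rule cycle_exps_stable) (use that in auto)
      then show ?thesis unfolding pJ by (simp only:) (rule depth_ci, use that in simp)
    qed
    show "depth_quot (ideal_pow J K) \<noteq> 2"
      using depth_cycle_gap[OF K, where ?'k = 'k] unfolding pJ by linarith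
  qed simp
  moreover have "monomial_ideal I" "monomial_ideal J"
    unfolding I_def J_def by (intro monomial_ideal_mspan upset_embedded_exps upset_cycle_exps)+
  ultimately show ?thesis unfolding K_def by (intro exI[of _ I] exI[of _ J]) auto
qed

end
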